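(* For every pair $(p,q)$ of integers such that $q\geq 21$ and $$q-1\;\leq\; p\;\leq\; \tfrac{1}{2}q^2-\tfrac{5}{2}q+9,$$ there exists an indecomposable, $2$-step nilpotent real Lie algebra of type $(p,q)$ which is not an Einstein nilradical.
   Context: All Lie algebras are finite-dimensional and real. A $2$-step nilpotent Lie algebra $\mathfrak{n}$ is said to be of type $(p,q)$ if $\dim\mathfrak{n}=p+q$ and $\dim[\mathfrak{n},\mathfrak{n}]=p$. A Lie algebra is indecomposable if it cannot be written as a direct sum of (two nonzero) ideals. A nilpotent Lie algebra $\mathfrak{n}$ is called an Einstein nilradical if it admits an inner product $\langle\cdot,\cdot\rangle$ such that $\mathrm{Ric}_{\langle\cdot,\cdot\rangle}=cI+D$ for some $c\in\mathbb{R}$ and some derivation $D\in\mathrm{Der}(\mathfrak{n})$, where $\mathrm{Ric}_{\langle\cdot,\cdot\rangle}$ is the Ricci operator (on $\mathfrak{n}$) of the left-invariant Riemannian metric defined by $\langle\cdot,\cdot\rangle$ on the simply connected nilpotent Lie group $N$ with Lie algebra $\mathfrak{n}$. (Such metrics are called nilsolitons.) *)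

theory Defs
  imports "HOL-Analysis.Analysis" "HOL-Analysis.Finite_Function_Topology"
begin

text \<open>A finite-dimensional real Lie algebra is a finite-dimensional subspace \<open>V\<close> of a real
  vector space together with a bracket \<open>br\<close>, of which only the values on \<open>V\<close> matter. Dimensions are
  thus ordinary natural numbers, and every finite-dimensional real Lie algebra is isomorphic to one
  carried by a subspace of the space of finitely supported real sequences.\<close>

definition linear_on :: "'a::real_vector set \<Rightarrow> ('a \<Rightarrow> 'b::real_vector) \<Rightarrow> bool" where
  "linear_on V f \<longleftrightarrow>
     (\<forall>x\<in>V. \<forall>y\<in>V. f (x + y) = f x + f y) \<and> (\<forall>c. \<forall>x\<in>V. f (c *\<^sub>R x) = c *\<^sub>R f x)"

definition bilinear_on :: "'a::real_vector set \<Rightarrow> ('a \<Rightarrow> 'a \<Rightarrow> 'b::real_vector) \<Rightarrow> bool" where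
  "bilinear_on V f \<longleftrightarrow> (\<forall>x\<in>V. linear_on V (f x)) \<and> (\<forall>y\<in>V. linear_on V (\<lambda>x. f x y))"

definition fin_dim_subspace :: "'a::real_vector set \<Rightarrow> bool" where
  "fin_dim_subspace V \<longleftrightarrow> (\<exists>B. finite B \<and> V = span B)"

definition lie_algebra :: "'a::real_vector set \<Rightarrow> ('a \<Rightarrow> 'a \<Rightarrow> 'a) \<Rightarrow> bool" where
  "lie_algebra V br \<longleftrightarrow>
     fin_dim_subspace V \<and>
     (\<forall>x\<in>V. \<forall>y\<in>V. br x y \<in> V) \<and>
     bilinear_on V br \<and>
     (\<forall>x\<in>V. br x x = 0) \<and>
     (\<forall>x\<in>V. \<forall>y\<in>V. \<forall>z\<in>V. br x (br y z) + br y (br z x) + br z (br x y) = 0)"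

definition bracket_span ::
    "('a::real_vector \<Rightarrow> 'a \<Rightarrow> 'a) \<Rightarrow> 'a set \<Rightarrow> 'a set \<Rightarrow> 'a set" where
  "bracket_span br A B = span {br x y | x y. x \<in> A \<and> y \<in> B}"

definition two_step_nilpotent :: "'a::real_vector set \<Rightarrow> ('a \<Rightarrow> 'a \<Rightarrow> 'a) \<Rightarrow> bool" where
  "two_step_nilpotent V br \<longleftrightarrow>
     bracket_span br V V \<noteq> {0} \<and> bracket_span br V (bracket_span br V V) = {0}"

definition has_type :: "'a::real_vector set \<Rightarrow> ('a \<Rightarrow> 'a \<Rightarrow> 'a) \<Rightarrow> nat \<Rightarrow> nat \<Rightarrow> bool" where
  "has_type V br p q \<longleftrightarrow> dim V = p + q \<and> dim (bracket_span br V V) = p"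

definition lie_ideal ::
    "'a::real_vector set \<Rightarrow> ('a \<Rightarrow> 'a \<Rightarrow> 'a) \<Rightarrow> 'a set \<Rightarrow> bool" where
  "lie_ideal V br I \<longleftrightarrow> subspace I \<and> I \<subseteq> V \<and> (\<forall>x\<in>V. \<forall>y\<in>I. br x y \<in> I)"

definition indecomposable :: "'a::real_vector set \<Rightarrow> ('a \<Rightarrow> 'a \<Rightarrow> 'a) \<Rightarrow> bool" where
  "indecomposable V br \<longleftrightarrow>
     \<not> (\<exists>I J. lie_ideal V br I \<and> lie_ideal V br J \<and> I \<noteq> {0} \<and> J \<noteq> {0} \<and>
          I \<inter> J = {0} \<and> V = {x + y | x y. x \<in> I \<and> y \<in> J})"

definition derivation_on ::
    "'a::real_vector set \<Rightarrow> ('a \<Rightarrow> 'a \<Rightarrow> 'a) \<Rightarrow> ('a \<Rightarrow> 'a) \<Rightarrow> bool" where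
  "derivation_on V br D \<longleftrightarrow>
     D ` V \<subseteq> V \<and> linear_on V D \<and>
     (\<forall>x\<in>V. \<forall>y\<in>V. D (br x y) = br (D x) y + br x (D y))"

definition inner_product_on :: "'a::real_vector set \<Rightarrow> ('a \<Rightarrow> 'a \<Rightarrow> real) \<Rightarrow> bool" where
  "inner_product_on V ip \<longleftrightarrow>
     bilinear_on V ip \<and> (\<forall>x\<in>V. \<forall>y\<in>V. ip x y = ip y x) \<and> (\<forall>x\<in>V. x \<noteq> 0 \<longrightarrow> ip x x > 0)"

definition riesz :: "'a::real_vector set \<Rightarrow> ('a \<Rightarrow> 'a \<Rightarrow> real) \<Rightarrow> ('a \<Rightarrow> real) \<Rightarrow> 'a" where
  "riesz V ip \<phi> = (THE z. z \<in> V \<and> (\<forall>w\<in>V. ip z w = \<phi> w))"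

lemma riesz_ex1:
  assumes V: "fin_dim_subspace V" and ip: "inner_product_on V ip" and \<phi>: "linear_on V \<phi>"
  shows "\<exists>!z. z \<in> V \<and> (\<forall>w\<in>V. ip z w = \<phi> w)"
proof -
  obtain B where B: "finite B" "V = span B"
    using V unfolding fin_dim_subspace_def by blast
  have subV: "subspace V"
    by (simp add: B)
  have add1: "ip (x + y) z = ip x z + ip y z" and add2: "ip z (x + y) = ip z x + ip z y"
    and sc1: "ip (c *\<^sub>R x) z = c * ip x z" and sc2: "ip z (c *\<^sub>R x) = c * ip z x"
    and sym: "ip x z = ip z x"
    if "x \<in> V" "y \<in> V" "z \<in> V" for x y z c
    using ip that unfolding inner_product_on_def bilinear_on_def linear_on_def by auto
  have pos: "ip x x > 0" if "x \<in> V" "x \<noteq> 0" for x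
    using ip that unfolding inner_product_on_def by auto
  have ex: "\<forall>\<phi>. linear_on V \<phi> \<longrightarrow> (\<exists>z\<in>span A. \<forall>w\<in>span A. ip z w = \<phi> w)"
    if "finite A" "A \<subseteq> V" for A
    using that
  proof (induction A rule: finite_induct)
    case empty
    have "ip 0 0 = \<psi> 0" if "linear_on V \<psi>" for \<psi>
    proof -
      have "0 \<in> V" using subV subspace_0 by blast
      then have "\<psi> (0 *\<^sub>R 0) = 0 *\<^sub>R \<psi> 0" using that unfolding linear_on_def by blast
      moreover have "ip (0 *\<^sub>R 0) 0 = 0 * ip 0 0" using sc1 \<open>0 \<in> V\<close> by blast
      ultimately show ?thesis by simp
    qed
    then show ?case by simp
  next
    case (insert b A)
    have b: "b \<in> V" and AV: "A \<subseteq> V" using insert.prems by auto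
    have sA: "span A \<subseteq> V" using AV subV span_minimal by blast
    show ?case
    proof (intro allI impI)
      fix \<psi> :: "'a \<Rightarrow> real" assume \<psi>: "linear_on V \<psi>"
      have \<psi>a: "\<psi> (x + y) = \<psi> x + \<psi> y" and \<psi>s: "\<psi> (c *\<^sub>R x) = c * \<psi> x"
        if "x \<in> V" "y \<in> V" for x y c
        using \<psi> that unfolding linear_on_def by auto
      obtain z where z: "z \<in> span A" "\<And>w. w \<in> span A \<Longrightarrow> ip z w = \<psi> w"
        using insert.IH[OF AV, rule_format, OF \<psi>] by blast
      show "\<exists>z\<in>span (insert b A). \<forall>w\<in>span (insert b A). ip z w = \<psi> w"
      proof (cases "b \<in> span A")
        case True
        then have "span (insert b A) = span A" by (rule span_redundant)
        then show ?thesis using z by auto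
      next
        case False
        have "linear_on V (ip b)"
          using ip b by (simp add: inner_product_on_def bilinear_on_def)
        then obtain u where u: "u \<in> span A" "\<And>w. w \<in> span A \<Longrightarrow> ip u w = ip b w"
          using insert.IH[OF AV, rule_format, of "ip b"] by blast
        define e where "e = b + (-1) *\<^sub>R u"
        have uV: "u \<in> V" and zV: "z \<in> V" using u z sA by auto
        have eV: "e \<in> V" using b uV subV unfolding e_def
          by (meson subspace_add subspace_scale)
        have mV: "c *\<^sub>R x \<in> V" if "x \<in> V" for c x using that subV by (meson subspace_scale)
        have e0: "e \<noteq> 0" using False u(1) unfolding e_def by auto
        have eA: "ip e w = 0" if "w \<in> span A" for w
        proof -
          have "w \<in> V" using that sA by blast
          then show ?thesis
            using u(2)[OF that] add1[OF b mV[OF uV], of w "-1"] sc1[OF uV uV, of w "-1"]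
            unfolding e_def by simp
        qed
        have "ip e e = ip e b + (-1) * ip e u"
          using add2[OF b mV[OF uV] eV, of "-1"] sc2[OF uV uV eV, of "-1"] by (simp add: e_def)
        then have eb: "ip e b > 0" using eA[OF u(1)] pos[OF eV e0] by simp
        define t where "t = (\<psi> b - ip z b) / ip e b"
        define y where "y = z + t *\<^sub>R e"
        have "y \<in> span (insert b A)"
        proof -
          have "z \<in> span (insert b A)" "u \<in> span (insert b A)" "b \<in> span (insert b A)"
            using z(1) u(1) span_mono[of A "insert b A"] span_base[of b "insert b A"] by auto
          then show ?thesis unfolding y_def e_def by (intro span_add span_scale)
        qed
        moreover have "ip y w = \<psi> w" if wbA: "w \<in> span (insert b A)" for w
        proof -
          obtain k where k: "w - k *\<^sub>R b \<in> span A"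
            using wbA unfolding span_breakdown_eq by blast
          define v where "v = w - k *\<^sub>R b"
          have w: "w = v + k *\<^sub>R b" and vA: "v \<in> span A" using k by (auto simp: v_def)
          have vV: "v \<in> V" using vA sA by blast
          have wV: "w \<in> V" unfolding w using vV mV[OF b] subV subspace_add by blast
          have 1: "ip y w = ip z w + t * ip e w"
            unfolding y_def using add1[OF zV mV[OF eV] wV, of t] sc1[OF eV eV wV, of t] by simp
          have 2: "ip x w = ip x v + k * ip x b" if "x \<in> V" for x
            unfolding w using add2[OF vV mV[OF b] that, of k] sc2[OF b b that, of k] by simp
          have 3: "\<psi> w = \<psi> v + k * \<psi> b"
            unfolding w using \<psi>a[OF vV mV[OF b], of k] \<psi>s[OF b b, of k] by simp
          have "ip y w = \<psi> v + k * ip z b + t * (k * ip e b)"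
            using 1 2[OF zV] 2[OF eV] z(2)[OF vA] eA[OF vA] by simp
          also have "t * (k * ip e b) = k * (\<psi> b - ip z b)"
            using eb by (simp add: t_def)
          finally show ?thesis using 3 by (simp add: algebra_simps)
        qed
        ultimately show ?thesis by blast
      qed
    qed
  qed
  have "B \<subseteq> V" using B span_superset by blast
  then obtain z where z: "z \<in> V" "\<forall>w\<in>V. ip z w = \<phi> w"
    using ex[OF B(1) \<open>B \<subseteq> V\<close>, rule_format, OF \<phi>] B(2) by blast
  show ?thesis
  proof (rule ex1I[of _ z])
    show "z \<in> V \<and> (\<forall>w\<in>V. ip z w = \<phi> w)" using z by blast
  next
    fix y assume y: "y \<in> V \<and> (\<forall>w\<in>V. ip y w = \<phi> w)"
    have mz: "(-1) *\<^sub>R z \<in> V" using z(1) subV subspace_scale by blast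
    define d where "d = y + (-1) *\<^sub>R z"
    have d: "d \<in> V" unfolding d_def using y mz subV subspace_add by blast
    have "ip d d = ip y d + (-1) * ip z d"
      using add1[of y "(-1) *\<^sub>R z" d] sc1[OF z(1) z(1) d, of "-1"] y mz d by (simp add: d_def)
    then have "ip d d = 0" using y z d by simp
    then have "d = 0" using pos[OF d] by force
    then show "y = z" by (simp add: d_def)
  qed
qed

text \<open>The trace of an endomorphism of \<open>V\<close>, computed in a basis of \<open>V\<close>; the value does not depend
  on the basis.\<close>

definition trace_on :: "'a::real_vector set \<Rightarrow> ('a \<Rightarrow> 'a) \<Rightarrow> real" where
  "trace_on V f =
     (let B = (SOME B. B \<subseteq> V \<and> independent B \<and> V \<subseteq> span B)
      in \<Sum>b\<in>B. representation B (f b) b)"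

text \<open>The Levi-Civita connection of the left-invariant metric given by \<open>ip\<close>, on left-invariant
  vector fields. As \<open>ip Y Z\<close> is constant for left-invariant \<open>Y\<close>, \<open>Z\<close>, the terms of the Koszul
  formula that differentiate the metric vanish.\<close>

definition levi_civita ::
    "'a::real_vector set \<Rightarrow> ('a \<Rightarrow> 'a \<Rightarrow> 'a) \<Rightarrow> ('a \<Rightarrow> 'a \<Rightarrow> real) \<Rightarrow> 'a \<Rightarrow> 'a \<Rightarrow> 'a" where
  "levi_civita V br ip X Y =
     riesz V ip (\<lambda>Z. (ip (br X Y) Z - ip (br Y Z) X + ip (br Z X) Y) / 2)"

definition curvature ::
    "'a::real_vector set \<Rightarrow> ('a \<Rightarrow> 'a \<Rightarrow> 'a) \<Rightarrow> ('a \<Rightarrow> 'a \<Rightarrow> real) \<Rightarrow> 'a \<Rightarrow> 'a \<Rightarrow> 'a \<Rightarrow> 'a" where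
  "curvature V br ip X Y Z =
     (let nabla = levi_civita V br ip
      in nabla X (nabla Y Z) - nabla Y (nabla X Z) - nabla (br X Y) Z)"

definition ricci_form ::
    "'a::real_vector set \<Rightarrow> ('a \<Rightarrow> 'a \<Rightarrow> 'a) \<Rightarrow> ('a \<Rightarrow> 'a \<Rightarrow> real) \<Rightarrow> 'a \<Rightarrow> 'a \<Rightarrow> real" where
  "ricci_form V br ip X Y = trace_on V (\<lambda>Z. curvature V br ip Z X Y)"

definition ricci_operator ::
    "'a::real_vector set \<Rightarrow> ('a \<Rightarrow> 'a \<Rightarrow> 'a) \<Rightarrow> ('a \<Rightarrow> 'a \<Rightarrow> real) \<Rightarrow> 'a \<Rightarrow> 'a" where
  "ricci_operator V br ip X = riesz V ip (ricci_form V br ip X)"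

text \<open>To be used for nilpotent Lie algebras only; nilpotency is not part of the definition.\<close>

definition einstein_nilradical :: "'a::real_vector set \<Rightarrow> ('a \<Rightarrow> 'a \<Rightarrow> 'a) \<Rightarrow> bool" where
  "einstein_nilradical V br \<longleftrightarrow>
     (\<exists>ip. inner_product_on V ip \<and>
       (\<exists>c D. derivation_on V br D \<and> (\<forall>X\<in>V. ricci_operator V br ip X = c *\<^sub>R X + D X)))"

end

theory Submission
  imports Defs
begin

text \<open>
  The examples are graph Lie algebras: the vertices of a graph span a complement of the centre, and
  the bracket of two adjacent vertices is the central basis vector of their edge. A connected graph
  with \<open>q\<close> vertices and \<open>p\<close> edges gives an indecomposable algebra of type \<open>(p, q)\<close>, so it suffices
  to find, for each \<open>(p, q)\<close> in the range, a connected graph whose algebra admits no nilsoliton.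

  The obstruction comes from two facts about the Ricci operator of an arbitrary inner product on a
  two-step nilpotent algebra. It is trace-orthogonal to every derivation
  (\<open>trace_Ric_derivation\<close>). And if \<open>W\<close> is a subspace containing the derived algebra such that \<open>W\<close>
  and \<open>[W, W]\<close> are invariant under \<open>Ric\<close>, then \<open>tr\<^bsub>W\<^esub> Ric + tr\<^bsub>[W, W]\<^esub> Ric\<close> is
  nonnegative, because with the weights \<open>0, 1, 2\<close> along this filtration the bracket never lowers the
  total weight; it is positive if \<open>[V, V]\<close> is larger than \<open>[V, W]\<close>
  (\<open>trace_Ric_filtration_pos\<close>).

  Now let \<open>Ric = c I + D\<close> on a graph algebra. The diagonal of the derivation \<open>D\<close> in the graph basis
  is additive along edges, and orthogonality to all diagonal derivations is a linear system for
  its vertex entries. In the variables \<open>\<xi>\<^sub>v\<close> defined by \<open>D\<^sub>v\<^sub>v = - c (1 + \<xi>\<^sub>v) / 2\<close> it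
  reads \<open>\<xi>\<^sub>v + \<Sum>\<^bsub>u \<sim> v\<^esub> (\<xi>\<^sub>u + \<xi>\<^sub>v) = 1\<close>. The system determines \<open>\<xi>\<close>, and
  the inner product has disappeared from it. Suppose that \<open>H\<close> is a set of vertices (\<open>hubs\<close>) such
  that no derivation can move a non-hub towards a hub. Then the span \<open>W\<close> of the non-hubs and the
  centre is invariant, and the second fact says that \<open>\<Sum> (\<xi>\<^sub>u + \<xi>\<^sub>v)\<close> over the edges
  inside \<open>H\<close> is positive (\<open>einstein_nilradical_soliton_weights\<close>).

  It remains to find graphs with two adjacent hubs \<open>0\<close> and \<open>1\<close> and \<open>\<xi>\<^sub>0 + \<xi>\<^sub>1 \<le> 0\<close>. If there is
  no edge between non-hubs, the system can be solved by hand; letting the number of common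
  neighbours of the hubs grow covers \<open>q - 1 \<le> p \<le> 2 q - 4\<close> (\<open>sparse_family\<close>). If both hubs are
  adjacent to everything, then summing the system expresses \<open>\<Sum> \<xi>\<close> by \<open>\<xi>\<^sub>0 + \<xi>\<^sub>1\<close>, while
  positive definiteness bounds \<open>\<Sum> \<xi>\<close> from below by a quadratic function of an arbitrary test
  vector (\<open>soliton_weights_sum_ge\<close>). That bound gets better when edges are removed, so one test vector
  for one large graph serves for all its subgraphs and thus for all remaining \<open>p\<close>
  (\<open>dense_family\<close>). The largest graph consists, next to the hubs, of a clique on \<open>q - 4\<close>
  vertices, a vertex joined to two of them and a vertex joined to none; for \<open>q = 21\<close> its estimate is an
  equality.
\<close>

section \<open>Traces and orthonormal bases\<close>

lemma linear_on_0:
  assumes "linear_on V f" and "subspace V"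
  shows "f 0 = 0"
proof -
  have "0 \<in> V" using assms(2) subspace_0 by blast
  then have "f (0 *\<^sub>R 0) = 0 *\<^sub>R f 0" using assms(1) unfolding linear_on_def by blast
  then show ?thesis by simp
qed

lemma linear_on_sum:
  assumes f: "linear_on V f" and V: "subspace V" and g: "\<And>a. a \<in> A \<Longrightarrow> g a \<in> V"
  shows "f (\<Sum>a\<in>A. c a *\<^sub>R g a) = (\<Sum>a\<in>A. c a *\<^sub>R f (g a))"
  using g
proof (induction A rule: infinite_finite_induct)
  case (insert a A)
  have 1: "c a *\<^sub>R g a \<in> V" "(\<Sum>a\<in>A. c a *\<^sub>R g a) \<in> V"
    using insert.prems V by (auto intro!: subspace_scale subspace_sum)
  have "f (c a *\<^sub>R g a + (\<Sum>a\<in>A. c a *\<^sub>R g a)) = c a *\<^sub>R f (g a) + f (\<Sum>a\<in>A. c a *\<^sub>R g a)"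
    using f 1 insert.prems unfolding linear_on_def by auto
  then show ?case using insert by simp
qed (auto simp: linear_on_0[OF f V])

text \<open>Expanding the images of one basis in another one and exchanging the two summations turns the
  diagonal sum for the first basis into that for the second, so the trace may be computed in any basis.\<close>

lemma trace_on_basis:
  assumes B: "finite B" "independent B" "V = span B"
    and f: "linear_on V f" and fV: "f ` V \<subseteq> V"
  shows "trace_on V f = (\<Sum>b\<in>B. representation B (f b) b)"
proof -
  define C where "C = (SOME B. B \<subseteq> V \<and> independent B \<and> V \<subseteq> span B)"
  have "C \<subseteq> V \<and> independent C \<and> V \<subseteq> span C"
    unfolding C_def by (rule someI[of _ B]) (use B span_superset in auto)
  moreover from this have "finite C"
    using B independent_span_bound[of B C] by auto
  moreover have "subspace V" using B by simp
  ultimately have C: "finite C" "independent C" "V = span C" "C \<subseteq> V" and V: "subspace V"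
    by (simp_all add: span_minimal subset_antisym)
  have BV: "B \<subseteq> V" using B span_superset by auto
  have exp: "x = (\<Sum>b\<in>B. representation B x b *\<^sub>R b)" if "x \<in> V" for x
    using real_vector.sum_representation_eq[of B x B] B that by auto
  have expC: "x = (\<Sum>b\<in>C. representation C x b *\<^sub>R b)" if "x \<in> V" for x
    using real_vector.sum_representation_eq[of C x C] C that by auto
  have repsum: "representation X (\<Sum>a\<in>A. k a *\<^sub>R g a) b = (\<Sum>a\<in>A. k a * representation X (g a) b)"
    if "independent X" "V = span X" "\<And>a. a \<in> A \<Longrightarrow> g a \<in> V" for X A k b and g :: "'a \<Rightarrow> 'a"
    using that
    by (subst real_vector.representation_sum)
       (auto intro!: span_scale sum.cong simp: real_vector.representation_scale)
  have "(\<Sum>b\<in>B. representation B (f b) b)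
      = (\<Sum>b\<in>B. representation B (\<Sum>c\<in>C. representation C (f b) c *\<^sub>R c) b)"
    by (rule sum.cong[OF refl], subst expC[symmetric]) (use BV fV in auto)
  also have "\<dots> = (\<Sum>b\<in>B. \<Sum>c\<in>C. representation C (f b) c * representation B c b)"
    using B C by (intro sum.cong refl repsum[of _ _ "\<lambda>x. x"]) auto
  also have "\<dots> = (\<Sum>c\<in>C. \<Sum>b\<in>B. representation B c b * representation C (f b) c)"
    by (subst sum.swap) (simp add: mult.commute)
  also have "\<dots> = (\<Sum>c\<in>C. representation C (\<Sum>b\<in>B. representation B c b *\<^sub>R f b) c)"
    using C BV fV by (intro sum.cong refl repsum[symmetric]) auto
  also have "\<dots> = (\<Sum>c\<in>C. representation C (f c) c)"
  proof (rule sum.cong[OF refl])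
    fix c assume "c \<in> C"
    then have "f c = f (\<Sum>b\<in>B. representation B c b *\<^sub>R b)" using exp C by auto
    also have "\<dots> = (\<Sum>b\<in>B. representation B c b *\<^sub>R f b)"
      using BV by (intro linear_on_sum[OF f V]) auto
    finally show "representation C (\<Sum>b\<in>B. representation B c b *\<^sub>R f b) c = representation C (f c) c"
      by simp
  qed
  finally show ?thesis unfolding trace_on_def Let_def C_def by simp
qed

lemma linear_onD:
  assumes "linear_on V f" "x \<in> V" "y \<in> V"
  shows "f (x + y) = f x + f y" "f (c *\<^sub>R x) = c *\<^sub>R f x"
  using assms by (auto simp: linear_on_def)

definition orthonormal_basis ::
    "'a::real_vector set \<Rightarrow> ('a \<Rightarrow> 'a \<Rightarrow> real) \<Rightarrow> 'a set \<Rightarrow> bool" where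
  "orthonormal_basis V ip B \<longleftrightarrow>
     finite B \<and> V = span B \<and> (\<forall>a\<in>B. \<forall>b\<in>B. ip a b = (if a = b then 1 else 0))"

locale inner_product_subspace =
  fixes V :: "'a::real_vector set" and ip :: "'a \<Rightarrow> 'a \<Rightarrow> real"
  assumes fin_dim: "fin_dim_subspace V" and ip: "inner_product_on V ip"
begin

lemma subspace_V: "subspace V"
  using fin_dim by (auto simp: fin_dim_subspace_def)

lemma V_closed [simp, intro]:
  "0 \<in> V" "x \<in> V \<Longrightarrow> y \<in> V \<Longrightarrow> x + y \<in> V" "x \<in> V \<Longrightarrow> y \<in> V \<Longrightarrow> x - y \<in> V"
  "x \<in> V \<Longrightarrow> k *\<^sub>R x \<in> V" "x \<in> V \<Longrightarrow> - x \<in> V"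
  using subspace_V by (auto simp: subspace_0 subspace_add subspace_diff subspace_scale subspace_neg)

lemma V_sum [intro]: "(\<And>a. a \<in> A \<Longrightarrow> g a \<in> V) \<Longrightarrow> (\<Sum>a\<in>A. g a) \<in> V"
  using subspace_V by (rule subspace_sum)

lemma ip_linear: "x \<in> V \<Longrightarrow> linear_on V (ip x)" "y \<in> V \<Longrightarrow> linear_on V (\<lambda>x. ip x y)"
  using ip by (auto simp: inner_product_on_def bilinear_on_def)

lemma ip_sym: "x \<in> V \<Longrightarrow> y \<in> V \<Longrightarrow> ip x y = ip y x"
  using ip by (auto simp: inner_product_on_def)

lemma ip_pos: "x \<in> V \<Longrightarrow> x \<noteq> 0 \<Longrightarrow> ip x x > 0"
  using ip by (auto simp: inner_product_on_def)

lemma ip_simps: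
  assumes "x \<in> V" "y \<in> V" "z \<in> V"
  shows "ip (x + y) z = ip x z + ip y z" "ip z (x + y) = ip z x + ip z y"
    "ip (k *\<^sub>R x) z = k * ip x z" "ip z (k *\<^sub>R x) = k * ip z x"
  using ip_linear[of z] assms unfolding linear_on_def by auto

lemma ip_diff:
  assumes "x \<in> V" "y \<in> V" "z \<in> V"
  shows "ip (x - y) z = ip x z - ip y z" "ip z (x - y) = ip z x - ip z y"
  using ip_simps[of x "(-1) *\<^sub>R y" z] ip_simps(3,4)[of y y z "-1"] assms by auto

lemma ip_zero: "x \<in> V \<Longrightarrow> ip 0 x = 0" "x \<in> V \<Longrightarrow> ip x 0 = 0"
  using ip_linear[of x] linear_on_0[OF _ subspace_V] by blast+

lemma ip_sum:
  assumes "\<And>a. a \<in> A \<Longrightarrow> g a \<in> V" "x \<in> V"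
  shows "ip (\<Sum>a\<in>A. k a *\<^sub>R g a) x = (\<Sum>a\<in>A. k a * ip (g a) x)"
    "ip x (\<Sum>a\<in>A. k a *\<^sub>R g a) = (\<Sum>a\<in>A. k a * ip x (g a))"
  using linear_on_sum[OF ip_linear(2) subspace_V, of x A g k]
    linear_on_sum[OF ip_linear(1) subspace_V, of x A g k] assms by auto

text \<open>Gram-Schmidt. An existing orthonormal set is kept, which allows bases adapted to a flag.\<close>

lemma orthonormal_extend:
  assumes "finite S" "S \<subseteq> V" "finite B" "B \<subseteq> V"
    "\<forall>a\<in>B. \<forall>b\<in>B. ip a b = (if a = b then 1 else 0)"
  shows "\<exists>C. finite C \<and> B \<subseteq> C \<and> C \<subseteq> V \<and> span C = span (B \<union> S) \<and>
    (\<forall>a\<in>C. \<forall>b\<in>C. ip a b = (if a = b then 1 else 0))"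
  using assms(1,2)
proof (induction S rule: finite_induct)
  case empty
  then show ?case using assms by (intro exI[of _ B]) auto
next
  case (insert x S)
  then obtain C where C: "finite C" "B \<subseteq> C" "C \<subseteq> V" "span C = span (B \<union> S)"
    and on: "\<forall>a\<in>C. \<forall>b\<in>C. ip a b = (if a = b then 1 else 0)" by auto
  have x: "x \<in> V" using insert by auto
  have sp: "span (insert x C) = span (B \<union> insert x S)"
    using C(4) by (metis Un_insert_right span_insert)
  show ?case
  proof (cases "x \<in> span C")
    case True
    then have "span C = span (B \<union> insert x S)" using sp by (simp add: span_redundant)
    then show ?thesis using C on by blast
  next
    case False
    define u where "u = (\<Sum>c\<in>C. ip x c *\<^sub>R c)"
    define e where "e = x - u"
    have uV: "u \<in> V" unfolding u_def using C by (intro V_sum V_closed) auto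
    have uC: "u \<in> span C" unfolding u_def by (intro span_sum span_scale span_base)
    have eV: "e \<in> V" and e0: "e \<noteq> 0" using x uV uC False by (auto simp: e_def)
    have ec: "ip e c = 0" if "c \<in> C" for c
    proof -
      have "ip u c = (\<Sum>a\<in>C. ip x a * ip a c)"
        unfolding u_def using C that by (intro ip_sum) auto
      also have "\<dots> = (\<Sum>a\<in>C. if a = c then ip x a else 0)"
        using on that by (intro sum.cong) auto
      also have "\<dots> = ip x c" using C that by simp
      finally show ?thesis unfolding e_def using ip_diff(1)[of x u c] x uV C that by auto
    qed
    define k where "k = 1 / sqrt (ip e e)"
    define f where "f = k *\<^sub>R e"
    have pos: "ip e e > 0" using ip_pos eV e0 by auto
    then have k0: "k \<noteq> 0" by (simp add: k_def)
    have fV: "f \<in> V" using eV by (simp add: f_def)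
    have "ip f f = k * (k * ip e e)"
      unfolding f_def using eV ip_simps(3)[of e e "k *\<^sub>R e" k] ip_simps(4)[of e e e k] by auto
    also have "\<dots> = 1" using pos by (simp add: k_def field_simps)
    finally have ff: "ip f f = 1" .
    have fc: "ip f c = 0" "ip c f = 0" if "c \<in> C" for c
    proof -
      show "ip f c = 0" unfolding f_def using eV ip_simps(3)[of e e c k] ec that C by auto
      then show "ip c f = 0" using ip_sym[of c f] fV that C by auto
    qed
    have "span (insert f C) = span (insert x C)"
    proof (rule span_eq[THEN iffD2], intro conjI subsetI)
      fix y assume "y \<in> insert f C"
      moreover have "f \<in> span (insert x C)"
        unfolding f_def e_def using uC span_mono[of C "insert x C"]
        by (intro span_scale span_diff) (auto intro: span_base)
      ultimately show "y \<in> span (insert x C)" by (auto intro: span_base)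
    next
      fix y assume "y \<in> insert x C"
      moreover have "x = (1/k) *\<^sub>R f + u" using k0 by (simp add: f_def e_def)
      moreover have "(1/k) *\<^sub>R f + u \<in> span (insert f C)"
        using uC span_mono[of C "insert f C"]
        by (intro span_add span_scale) (auto intro: span_base)
      ultimately show "y \<in> span (insert f C)" by (auto intro: span_base)
    qed
    then have "span (insert f C) = span (B \<union> insert x S)" using sp by simp
    moreover have "\<forall>a\<in>insert f C. \<forall>b\<in>insert f C. ip a b = (if a = b then 1 else 0)"
      using on ff fc by auto
    ultimately show ?thesis using C fV by (intro exI[of _ "insert f C"]) auto
  qed
qed

lemma fin_dim_sub:
  assumes "subspace W" "W \<subseteq> V"
  shows "\<exists>S. finite S \<and> S \<subseteq> W \<and> W = span S"
proof -
  obtain S where S: "S \<subseteq> W" "independent S" "W \<subseteq> span S"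
    using maximal_independent_subset[of W] by blast
  obtain T where T: "finite T" "V = span T" using fin_dim by (auto simp: fin_dim_subspace_def)
  have "finite S" using independent_span_bound[of T S] S T assms by auto
  moreover have "span S = W" using S assms by (simp add: span_minimal subset_antisym)
  ultimately show ?thesis using S by auto
qed

text \<open>An orthonormal basis of \<open>U\<close> is extended to \<open>W\<close> and then to \<open>V\<close>; nothing added later falls back
  into the smaller spaces.\<close>

lemma adapted_orthonormal_basis:
  assumes U: "subspace U" "U \<subseteq> W" and W: "subspace W" "W \<subseteq> V"
  shows "\<exists>B. orthonormal_basis V ip B \<and> orthonormal_basis W ip (B \<inter> W) \<and> orthonormal_basis U ip (B \<inter> U)"
proof -
  obtain S where S: "finite S" "S \<subseteq> U" "U = span S" using fin_dim_sub[of U] assms by auto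
  obtain T where T: "finite T" "T \<subseteq> W" "W = span T" using fin_dim_sub[of W] assms by auto
  obtain R where R: "finite R" "R \<subseteq> V" "V = span R" using fin_dim_sub[of V] subspace_V by auto
  have sub: "S \<subseteq> V" "T \<subseteq> V" using S(2) T(2) U(2) W(2) by (blast intro: subset_trans)+
  obtain C1 where C1: "finite C1" "C1 \<subseteq> V" "span C1 = U"
    "\<forall>a\<in>C1. \<forall>b\<in>C1. ip a b = (if a = b then 1 else 0)"
    using orthonormal_extend[OF S(1) sub(1), of "{}"] S(3) by auto
  obtain C2 where C2: "finite C2" "C1 \<subseteq> C2" "C2 \<subseteq> V" "span C2 = span (C1 \<union> T)"
    "\<forall>a\<in>C2. \<forall>b\<in>C2. ip a b = (if a = b then 1 else 0)"
    using orthonormal_extend[OF T(1) sub(2) C1(1,2,4)] by blast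
  obtain C3 where C3: "finite C3" "C2 \<subseteq> C3" "C3 \<subseteq> V" "span C3 = span (C2 \<union> R)"
    "\<forall>a\<in>C3. \<forall>b\<in>C3. ip a b = (if a = b then 1 else 0)"
    using orthonormal_extend[OF R(1,2) C2(1,3,5)] by blast
  have s2: "span C2 = W"
  proof -
    have "C1 \<union> T \<subseteq> W" using C1(3) span_superset[of C1] U(2) T by auto
    then have "span (C1 \<union> T) \<subseteq> W" using W by (simp add: span_minimal)
    moreover have "W \<subseteq> span (C1 \<union> T)" using T span_mono[of T "C1 \<union> T"] by auto
    ultimately show ?thesis using C2 by auto
  qed
  have s3: "span C3 = V"
  proof -
    have "C2 \<union> R \<subseteq> V" using C2 R by auto
    then have "span (C2 \<union> R) \<subseteq> V" using subspace_V by (simp add: span_minimal)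
    moreover have "V \<subseteq> span (C2 \<union> R)" using R span_mono[of R "C2 \<union> R"] by auto
    ultimately show ?thesis using C3 by auto
  qed
  \<comment> \<open>A basis vector outside \<open>X\<close> is orthogonal to the span of \<open>X\<close>, so it cannot lie in it.\<close>
  have key: "C3 \<inter> span X = X" if X: "X \<subseteq> C3" for X
  proof
    show "C3 \<inter> span X \<subseteq> X"
    proof
      fix b assume b: "b \<in> C3 \<inter> span X"
      show "b \<in> X"
      proof (rule ccontr)
        assume nb: "b \<notin> X"
        have "span X \<subseteq> {y \<in> V. ip b y = 0}"
        proof (rule span_minimal)
          show "X \<subseteq> {y \<in> V. ip b y = 0}" using X nb b C3 by auto
          show "subspace {y \<in> V. ip b y = 0}"
            unfolding subspace_def using b C3 ip_simps ip_zero by auto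
        qed
        then have "ip b b = 0" using b by auto
        then show False using b C3 by auto
      qed
    qed
  qed (use X in \<open>auto intro: span_base\<close>)
  have "C3 \<inter> W = C2" using key[of C2] C3 s2 by auto
  moreover have "C3 \<inter> U = C1" using key[of C1] C3 C2 C1 by auto
  ultimately show ?thesis
    unfolding orthonormal_basis_def using C1 C2 C3 s2 s3 by (intro exI[of _ C3]) auto
qed

lemma orthonormal_basis_exists: "\<exists>B. orthonormal_basis V ip B"
  using adapted_orthonormal_basis[of V V] subspace_V by auto

context
  fixes B W assumes B: "orthonormal_basis W ip B" and W: "W \<subseteq> V"
begin

lemma orthonormal_basisD: "finite B" "W = span B" "b \<in> B \<Longrightarrow> b \<in> V" "b \<in> B \<Longrightarrow> b \<in> W" "subspace W"
  "a \<in> B \<Longrightarrow> b \<in> B \<Longrightarrow> ip a b = (if a = b then 1 else 0)"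
  using B W unfolding orthonormal_basis_def by (auto intro: span_base)

lemma onb_coeff:
  assumes "b \<in> B" shows "ip (\<Sum>a\<in>B. k a *\<^sub>R a) b = k b"
proof -
  have "ip (\<Sum>a\<in>B. k a *\<^sub>R a) b = (\<Sum>a\<in>B. k a * ip a b)"
    using orthonormal_basisD assms by (intro ip_sum) auto
  also have "\<dots> = (\<Sum>a\<in>B. if a = b then k a else 0)" using orthonormal_basisD assms by (intro sum.cong) auto
  finally show ?thesis using orthonormal_basisD assms by simp
qed

lemma onb_expand: "x \<in> W \<Longrightarrow> x = (\<Sum>b\<in>B. ip x b *\<^sub>R b)"
proof -
  assume "x \<in> W"
  then obtain k where k: "x = (\<Sum>b\<in>B. k b *\<^sub>R b)"
    using span_finite[of B] orthonormal_basisD by auto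
  then have "ip x b = k b" if "b \<in> B" for b using onb_coeff that by simp
  then show ?thesis using k by simp
qed

lemma onb_independent: "independent B"
proof (rule independent_if_scalars_zero)
  show "finite B" using orthonormal_basisD by simp
  fix f x assume "(\<Sum>x\<in>B. f x *\<^sub>R x) = 0" "x \<in> B"
  then show "f x = 0" using onb_coeff[of x f] ip_zero orthonormal_basisD by auto
qed

lemma onb_representation: "x \<in> W \<Longrightarrow> b \<in> B \<Longrightarrow> representation B x b = ip x b"
proof -
  assume x: "x \<in> W" and b: "b \<in> B"
  have "x = (\<Sum>b\<in>B. representation B x b *\<^sub>R b)"
    using real_vector.sum_representation_eq[of B x B] onb_independent orthonormal_basisD x by auto
  then show ?thesis using onb_coeff[OF b] by metis
qed

lemma trace_on_onb:
  assumes "linear_on W f" "f ` W \<subseteq> W"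
  shows "trace_on W f = (\<Sum>b\<in>B. ip (f b) b)"
proof -
  have "trace_on W f = (\<Sum>b\<in>B. representation B (f b) b)"
    using orthonormal_basisD onb_independent assms by (intro trace_on_basis) auto
  also have "\<dots> = (\<Sum>b\<in>B. ip (f b) b)"
    using assms orthonormal_basisD by (intro sum.cong refl onb_representation) auto
  finally show ?thesis .
qed

lemma parseval: "x \<in> W \<Longrightarrow> y \<in> V \<Longrightarrow> ip x y = (\<Sum>b\<in>B. ip x b * ip b y)"
  using onb_expand[of x] ip_sum(1)[of B "\<lambda>x. x" y "ip x"] orthonormal_basisD by auto

end
end

section \<open>The Ricci operator of a two-step nilpotent Lie algebra\<close>

locale metric_two_step = inner_product_subspace V ip
  for V :: "'a::real_vector set" and ip :: "'a \<Rightarrow> 'a \<Rightarrow> real" +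
  fixes br :: "'a \<Rightarrow> 'a \<Rightarrow> 'a"
  assumes lie: "lie_algebra V br"
    and central: "x \<in> V \<Longrightarrow> y \<in> V \<Longrightarrow> z \<in> V \<Longrightarrow> br x (br y z) = 0"
begin

lemma br_closed [simp, intro]: "x \<in> V \<Longrightarrow> y \<in> V \<Longrightarrow> br x y \<in> V"
  using lie by (auto simp: lie_algebra_def)

lemma br_linear: "x \<in> V \<Longrightarrow> linear_on V (br x)" "y \<in> V \<Longrightarrow> linear_on V (\<lambda>x. br x y)"
  using lie by (auto simp: lie_algebra_def bilinear_on_def)

lemmas br_simps = br_linear[THEN linear_onD(1)] br_linear[THEN linear_onD(2)]

lemma br_self: "x \<in> V \<Longrightarrow> br x x = 0"
  using lie by (auto simp: lie_algebra_def)

lemma br_anti: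
  assumes "x \<in> V" "y \<in> V" shows "br y x = - br x y"
proof -
  have "br (x + y) (x + y) = 0" using assms br_self by auto
  moreover have "br (x + y) (x + y) = (br x x + br y x) + (br x y + br y y)"
    using assms by (simp add: br_simps)
  ultimately have "br y x + br x y = 0" using assms br_self by simp
  then show ?thesis by (rule eq_neg_iff_add_eq_0[THEN iffD2])
qed

lemma ip_neg: "x \<in> V \<Longrightarrow> y \<in> V \<Longrightarrow> ip (- x) y = - ip x y" "x \<in> V \<Longrightarrow> y \<in> V \<Longrightarrow> ip x (- y) = - ip x y"
  using ip_simps(3)[of x x y "-1"] ip_simps(4)[of y y x "-1"] by auto

lemma central': "x \<in> V \<Longrightarrow> y \<in> V \<Longrightarrow> z \<in> V \<Longrightarrow> br (br y z) x = 0"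
  using br_anti[of x "br y z"] central by auto

lemma ip_eqI:
  assumes "x \<in> V" "y \<in> V" "\<And>z. z \<in> V \<Longrightarrow> ip x z = ip y z"
  shows "x = y"
proof (rule ccontr)
  assume "x \<noteq> y"
  then have "ip (x - y) (x - y) > 0" using assms by (intro ip_pos) auto
  moreover have "ip (x - y) (x - y) = 0"
    using assms ip_diff(1)[of x y "x - y"] by auto
  ultimately show False by simp
qed

lemma riesz_ip:
  assumes "linear_on V \<phi>"
  shows "riesz V ip \<phi> \<in> V" "w \<in> V \<Longrightarrow> ip (riesz V ip \<phi>) w = \<phi> w"
  using theI'[OF riesz_ex1[OF fin_dim ip assms]] unfolding riesz_def by auto

abbreviation nabla :: "'a \<Rightarrow> 'a \<Rightarrow> 'a" where "nabla \<equiv> levi_civita V br ip"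

lemma koszul:
  assumes "X \<in> V" "Y \<in> V"
  shows "nabla X Y \<in> V"
    and "Z \<in> V \<Longrightarrow> ip (nabla X Y) Z = (ip (br X Y) Z - ip (br Y Z) X + ip (br Z X) Y) / 2"
proof -
  have "linear_on V (\<lambda>Z. (ip (br X Y) Z - ip (br Y Z) X + ip (br Z X) Y) / 2)"
    unfolding linear_on_def using assms by (auto simp: br_simps ip_simps algebra_simps add_divide_distrib diff_divide_distrib)
  from riesz_ip[OF this] show "nabla X Y \<in> V"
    "Z \<in> V \<Longrightarrow> ip (nabla X Y) Z = (ip (br X Y) Z - ip (br Y Z) X + ip (br Z X) Y) / 2"
    unfolding levi_civita_def by auto
qed

lemma nabla_linear:
  "X \<in> V \<Longrightarrow> linear_on V (nabla X)" "Y \<in> V \<Longrightarrow> linear_on V (\<lambda>X. nabla X Y)"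
  unfolding linear_on_def
  by (auto intro!: ip_eqI simp: koszul ip_simps br_simps algebra_simps add_divide_distrib diff_divide_distrib)

lemmas nabla_simps = nabla_linear[THEN linear_onD(1)] nabla_linear[THEN linear_onD(2)]

lemma derived_subspace: "subspace (bracket_span br A C)"
  by (simp add: bracket_span_def)

lemma derived_subset: "A \<subseteq> V \<Longrightarrow> C \<subseteq> V \<Longrightarrow> bracket_span br A C \<subseteq> V"
  unfolding bracket_span_def by (intro span_minimal subspace_V) auto

lemma br_in_derived: "x \<in> A \<Longrightarrow> y \<in> C \<Longrightarrow> br x y \<in> bracket_span br A C"
  unfolding bracket_span_def by (auto intro: span_base)

lemma br_derived:
  assumes "x \<in> V" "z \<in> bracket_span br V V"
  shows "br z x = 0"
proof -
  have "bracket_span br V V \<subseteq> {z \<in> V. br z x = 0}"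
    unfolding bracket_span_def
  proof (rule span_minimal)
    show "{br x y |x y. x \<in> V \<and> y \<in> V} \<subseteq> {z \<in> V. br z x = 0}" using central' assms by auto
    show "subspace {z \<in> V. br z x = 0}"
      unfolding subspace_def using assms linear_on_0[OF br_linear(2) subspace_V] by (auto simp: br_simps)
  qed
  then show ?thesis using assms by auto
qed

lemma onb_orthogonal:
  assumes "orthonormal_basis V ip B" "orthonormal_basis U ip (B \<inter> U)" "U \<subseteq> V"
    and "x \<in> U" "b \<in> B - U"
  shows "ip x b = 0"
proof -
  have "x = (\<Sum>c\<in>B \<inter> U. ip x c *\<^sub>R c)" using assms by (intro onb_expand) auto
  also have "ip \<dots> b = (\<Sum>c\<in>B \<inter> U. ip x c * ip c b)"
    using assms orthonormal_basisD[OF assms(1)] by (intro ip_sum) auto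
  also have "\<dots> = 0" using assms orthonormal_basisD[OF assms(1)] by (intro sum.neutral) auto
  finally show ?thesis .
qed

text \<open>The operator \<open>[\<cdot>, Z]\<close> maps into the derived algebra and kills it, so its diagonal vanishes in a
  basis adapted to the derived algebra.\<close>

lemma trace_ad_zero:
  assumes B: "orthonormal_basis V ip B" and Z: "Z \<in> V"
  shows "(\<Sum>b\<in>B. ip (br b Z) b) = 0"
proof -
  obtain C where C: "orthonormal_basis V ip C"
      "orthonormal_basis (bracket_span br V V) ip (C \<inter> bracket_span br V V)"
    using adapted_orthonormal_basis[of "bracket_span br V V" V] derived_subspace derived_subset
      subspace_V by blast
  have "(\<Sum>b\<in>B. ip (br b Z) b) = trace_on V (\<lambda>x. br x Z)"
    using Z B by (intro trace_on_onb[symmetric] br_linear) auto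
  also have "\<dots> = (\<Sum>b\<in>C. ip (br b Z) b)"
    using Z C by (intro trace_on_onb br_linear) auto
  also have "\<dots> = 0"
  proof (rule sum.neutral, intro ballI)
    fix b assume b: "b \<in> C"
    then have bV: "b \<in> V" using orthonormal_basisD[OF C(1)] by auto
    show "ip (br b Z) b = 0"
    proof (cases "b \<in> bracket_span br V V")
      case True
      then show ?thesis using br_derived Z ip_zero bV by auto
    next
      case False
      then show ?thesis
        using onb_orthogonal[OF C derived_subset, of "br b Z" b] b bV Z br_in_derived by auto
    qed
  qed
  finally show ?thesis .
qed

lemma curvature_in: "X \<in> V \<Longrightarrow> Y \<in> V \<Longrightarrow> Z \<in> V \<Longrightarrow> curvature V br ip X Y Z \<in> V"
  unfolding curvature_def Let_def by (intro V_closed koszul(1) br_closed)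

lemma nabla_skew:
  assumes "X \<in> V" "U \<in> V" "W \<in> V"
  shows "ip (nabla X U) W = - ip U (nabla X W)"
proof -
  have "ip U (nabla X W) = ip (nabla X W) U" using assms koszul(1) by (intro ip_sym) auto
  then show ?thesis
    using assms koszul(2)[of X U W] koszul(2)[of X W U] br_anti[of U W] br_anti[of X U] br_anti[of X W]
    by (simp add: ip_neg)
qed

text \<open>The three terms of the curvature are traced separately. The first is the trace of an adjoint map.
  In the second, \<open>\<nabla>\<^sub>X\<close> is skew and the coefficients of the connection are multiplied out: the symmetric
  part cancels against the skew one, and the mixed terms vanish because brackets are central. The
  third is a single Koszul term.\<close>

lemma ricci_form_eq:
  assumes B: "orthonormal_basis V ip B" and X: "X \<in> V" and Y: "Y \<in> V"
  shows "ricci_form V br ip X Y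
    = (\<Sum>a\<in>B. \<Sum>b\<in>B. ip (br a b) X * ip (br a b) Y) / 4 - (\<Sum>a\<in>B. ip (br X a) (br Y a)) / 2"
proof -
  note bV = orthonormal_basisD(3)[OF B order.refl]
  have "linear_on V (\<lambda>Z. curvature V br ip Z X Y)"
    unfolding curvature_def Let_def linear_on_def
    using X Y by (auto simp: koszul nabla_simps br_simps algebra_simps)
  then have "ricci_form V br ip X Y = (\<Sum>a\<in>B. ip (curvature V br ip a X Y) a)"
    unfolding ricci_form_def using curvature_in X Y by (intro trace_on_onb[OF B]) auto
  also have "\<dots> = (\<Sum>a\<in>B. ip (nabla a (nabla X Y)) a - ip (nabla X (nabla a Y)) a - ip (nabla (br a X) Y) a)"
    unfolding curvature_def Let_def using X Y bV by (intro sum.cong refl) (simp add: ip_diff koszul)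
  also have "\<dots> = (\<Sum>a\<in>B. ip (nabla a (nabla X Y)) a) - (\<Sum>a\<in>B. ip (nabla X (nabla a Y)) a)
      - (\<Sum>a\<in>B. ip (nabla (br a X) Y) a)"
    by (simp add: sum_subtractf)
  also have "(\<Sum>a\<in>B. ip (nabla a (nabla X Y)) a) = (\<Sum>a\<in>B. ip (br a (nabla X Y)) a)"
  proof (rule sum.cong[OF refl])
    fix a assume "a \<in> B"
    then have a: "a \<in> V" "nabla X Y \<in> V" using bV X Y koszul by auto
    show "ip (nabla a (nabla X Y)) a = ip (br a (nabla X Y)) a"
      using a br_anti[of a "nabla X Y"] by (simp add: koszul br_self ip_zero ip_neg)
  qed
  also have "\<dots> = 0" using X Y koszul by (intro trace_ad_zero[OF B]) auto
  also have "(\<Sum>a\<in>B. ip (nabla (br a X) Y) a) = (\<Sum>a\<in>B. ip (br X a) (br Y a)) / 2"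
    unfolding sum_divide_distrib
  proof (rule sum.cong[OF refl])
    fix a assume "a \<in> B"
    then have a: "a \<in> V" using bV by auto
    have "br (br a X) Y = 0" "br a (br a X) = 0" using a X Y by (auto simp: central central')
    moreover have "ip (br Y a) (br a X) = - ip (br X a) (br Y a)"
      using a X Y br_anti[of X a] ip_sym[of "br X a" "br Y a"] by (simp add: ip_neg)
    ultimately show "ip (nabla (br a X) Y) a = ip (br X a) (br Y a) / 2"
      using a X Y by (simp add: koszul ip_zero)
  qed
  also have "(\<Sum>a\<in>B. ip (nabla X (nabla a Y)) a)
      = - (\<Sum>a\<in>B. \<Sum>b\<in>B. ip (br a b) X * ip (br a b) Y) / 4"
  proof -
    define \<alpha> where "\<alpha> a b = ip (br Y a) b" for a b
    define \<alpha>' where "\<alpha>' a b = ip (br X a) b" for a b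
    define \<sigma> where "\<sigma> a b = ip (br a b) Y" for a b
    define \<sigma>' where "\<sigma>' a b = ip (br a b) X" for a b
    have anti: "\<sigma> b a = - \<sigma> a b" "\<sigma>' b a = - \<sigma>' a b" if "a \<in> B" "b \<in> B" for a b
      using that bV X Y br_anti[of a b] by (auto simp: \<sigma>_def \<sigma>'_def ip_neg)
    \<comment> \<open>The part of the product that is skew in its two indices, hence sums to zero.\<close>
    define G where "G a b = (\<alpha> a b + \<alpha> b a) * (\<alpha>' a b - \<alpha>' b a - \<sigma>' a b)" for a b
    have "(\<Sum>a\<in>B. \<Sum>b\<in>B. G a b) = (\<Sum>a\<in>B. \<Sum>b\<in>B. G b a)" by (rule sum.swap)
    also have "\<dots> = (\<Sum>a\<in>B. \<Sum>b\<in>B. - G a b)"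
    proof (intro sum.cong refl)
      fix a b assume "a \<in> B" "b \<in> B"
      then have "\<sigma>' b a = - \<sigma>' a b" by (rule anti(2))
      then show "G b a = - G a b" by (simp add: G_def algebra_simps)
    qed
    finally have G0: "(\<Sum>a\<in>B. \<Sum>b\<in>B. G a b) = 0" by (simp add: sum_negf)
    have z: "(\<Sum>b\<in>B. ip (br X a) b * ip (br a b) Y) = 0" if a: "a \<in> B" for a
    proof -
      have "(\<Sum>b\<in>B. ip (br X a) b * ip (br a b) Y) = ip (br a (\<Sum>b\<in>B. ip (br X a) b *\<^sub>R b)) Y"
        using a bV X Y linear_on_sum[OF br_linear(1)[of a] subspace_V, of B "\<lambda>b. b" "ip (br X a)"]
          ip_sum(1)[of B "br a" Y "ip (br X a)"] by auto
      also have "(\<Sum>b\<in>B. ip (br X a) b *\<^sub>R b) = br X a"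
        using onb_expand[OF B order.refl, of "br X a"] a bV X by auto
      finally show ?thesis using central a bV X Y ip_zero by auto
    qed
    have S1: "(\<Sum>a\<in>B. \<Sum>b\<in>B. \<sigma> a b * \<alpha>' a b) = 0"
      using z by (simp add: \<sigma>_def \<alpha>'_def mult.commute)
    have "(\<Sum>a\<in>B. \<Sum>b\<in>B. \<sigma> a b * \<alpha>' b a) = (\<Sum>b\<in>B. \<Sum>a\<in>B. \<sigma> a b * \<alpha>' b a)" by (rule sum.swap)
    also have "\<dots> = (\<Sum>b\<in>B. \<Sum>a\<in>B. - (\<sigma> b a * \<alpha>' b a))"
    proof (intro sum.cong refl)
      fix a b assume "a \<in> B" "b \<in> B"
      then have "\<sigma> a b = - \<sigma> b a" using anti(1)[of b a] by simp
      then show "\<sigma> a b * \<alpha>' b a = - (\<sigma> b a * \<alpha>' b a)" by simp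
    qed
    finally have S2: "(\<Sum>a\<in>B. \<Sum>b\<in>B. \<sigma> a b * \<alpha>' b a) = 0" using S1 by (simp add: sum_negf)
    have "ip (nabla X (nabla a Y)) a = (\<Sum>b\<in>B. G a b + \<sigma> a b * \<alpha>' a b - \<sigma> a b * \<alpha>' b a - \<sigma>' a b * \<sigma> a b) / 4"
      if a: "a \<in> B" for a
    proof -
      have "ip (nabla X (nabla a Y)) a = - ip (nabla a Y) (nabla X a)"
        using a bV X Y koszul by (intro nabla_skew) auto
      also have "ip (nabla a Y) (nabla X a) = (\<Sum>b\<in>B. ip (nabla a Y) b * ip b (nabla X a))"
        using a bV X Y koszul by (intro parseval[OF B]) auto
      also have "\<dots> = (\<Sum>b\<in>B. - ((G a b + \<sigma> a b * \<alpha>' a b - \<sigma> a b * \<alpha>' b a - \<sigma>' a b * \<sigma> a b) / 4))"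
      proof (rule sum.cong[OF refl])
        fix b assume b: "b \<in> B"
        have "ip b (nabla X a) = ip (nabla X a) b" using a b bV X koszul by (intro ip_sym) auto
        moreover have "ip (nabla a Y) b = (- \<alpha> a b - \<alpha> b a - \<sigma> a b) / 2"
          using a b bV X Y br_anti[of Y a] br_anti[of a b]
          by (simp add: koszul \<alpha>_def \<sigma>_def ip_neg)
        moreover have "ip (nabla X a) b = (\<alpha>' a b - \<alpha>' b a - \<sigma>' a b) / 2"
          using a b bV X Y br_anti[of X b] by (simp add: koszul \<alpha>'_def \<sigma>'_def ip_neg)
        ultimately have "ip (nabla a Y) b * ip b (nabla X a)
            = (- \<alpha> a b - \<alpha> b a - \<sigma> a b) / 2 * ((\<alpha>' a b - \<alpha>' b a - \<sigma>' a b) / 2)"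
          by (simp only:)
        also have "\<dots> = - ((G a b + \<sigma> a b * \<alpha>' a b - \<sigma> a b * \<alpha>' b a - \<sigma>' a b * \<sigma> a b) / 4)"
          by (simp add: G_def field_simps)
        finally show "ip (nabla a Y) b * ip b (nabla X a)
            = - ((G a b + \<sigma> a b * \<alpha>' a b - \<sigma> a b * \<alpha>' b a - \<sigma>' a b * \<sigma> a b) / 4)" .
      qed
      finally show ?thesis by (simp add: sum_negf sum_divide_distrib)
    qed
    then have "(\<Sum>a\<in>B. ip (nabla X (nabla a Y)) a)
      = (\<Sum>a\<in>B. \<Sum>b\<in>B. G a b + \<sigma> a b * \<alpha>' a b - \<sigma> a b * \<alpha>' b a - \<sigma>' a b * \<sigma> a b) / 4"
      by (simp add: sum_divide_distrib)
    also have "\<dots> = - (\<Sum>a\<in>B. \<Sum>b\<in>B. \<sigma>' a b * \<sigma> a b) / 4"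
      using G0 S1 S2 by (simp add: sum.distrib sum_subtractf)
    finally show ?thesis by (simp add: \<sigma>_def \<sigma>'_def)
  qed
  finally show ?thesis by simp
qed

abbreviation Ric :: "'a \<Rightarrow> 'a" where "Ric \<equiv> ricci_operator V br ip"

lemma ricci_form_linear:
  assumes X: "X \<in> V"
  shows "linear_on V (ricci_form V br ip X)" "linear_on V (\<lambda>Y. ricci_form V br ip Y X)"
proof -
  obtain B where B: "orthonormal_basis V ip B" using orthonormal_basis_exists by blast
  have bV: "b \<in> V" if "b \<in> B" for b using orthonormal_basisD(3)[OF B order.refl that] .
  have add: "ricci_form V br ip X (Y + Z) = ricci_form V br ip X Y + ricci_form V br ip X Z"
    if "Y \<in> V" "Z \<in> V" for Y Z
  proof -
    have "(\<Sum>a\<in>B. \<Sum>b\<in>B. ip (br a b) X * ip (br a b) (Y + Z))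
        = (\<Sum>a\<in>B. \<Sum>b\<in>B. ip (br a b) X * ip (br a b) Y + ip (br a b) X * ip (br a b) Z)"
      using that bV by (intro sum.cong refl) (simp add: ip_simps distrib_left)
    moreover have "(\<Sum>a\<in>B. ip (br X a) (br (Y + Z) a)) = (\<Sum>a\<in>B. ip (br X a) (br Y a) + ip (br X a) (br Z a))"
      using that bV X by (intro sum.cong refl) (simp add: ip_simps br_simps)
    ultimately show ?thesis
      using X that by (simp add: ricci_form_eq[OF B] sum.distrib add_divide_distrib)
  qed
  have scale: "ricci_form V br ip X (k *\<^sub>R Y) = k * ricci_form V br ip X Y" if "Y \<in> V" for Y k
  proof -
    have "(\<Sum>a\<in>B. \<Sum>b\<in>B. ip (br a b) X * ip (br a b) (k *\<^sub>R Y))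
        = (\<Sum>a\<in>B. \<Sum>b\<in>B. k * (ip (br a b) X * ip (br a b) Y))"
      using that bV by (intro sum.cong refl) (simp add: ip_simps)
    moreover have "(\<Sum>a\<in>B. ip (br X a) (br (k *\<^sub>R Y) a)) = (\<Sum>a\<in>B. k * ip (br X a) (br Y a))"
      using that bV X by (intro sum.cong refl) (simp add: ip_simps br_simps)
    ultimately show ?thesis
      using X that by (simp add: ricci_form_eq[OF B] right_diff_distrib flip: sum_distrib_left)
  qed
  show "linear_on V (ricci_form V br ip X)"
    unfolding linear_on_def using add scale by auto
  moreover have "ricci_form V br ip Y X = ricci_form V br ip X Y" if "Y \<in> V" for Y
  proof -
    have "(\<Sum>a\<in>B. ip (br Y a) (br X a)) = (\<Sum>a\<in>B. ip (br X a) (br Y a))"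
      using that bV X by (intro sum.cong refl ip_sym) auto
    then show ?thesis using X that by (simp add: ricci_form_eq[OF B] mult.commute)
  qed
  ultimately show "linear_on V (\<lambda>Y. ricci_form V br ip Y X)"
    by (simp add: linear_on_def)
qed

lemma Ric_ip:
  assumes "X \<in> V"
  shows "Ric X \<in> V" "Y \<in> V \<Longrightarrow> ip (Ric X) Y = ricci_form V br ip X Y"
  unfolding ricci_operator_def using riesz_ip[OF ricci_form_linear(1)[OF assms]] by auto

lemma Ric_linear: "linear_on V Ric"
  unfolding linear_on_def
  using ricci_form_linear(2)[THEN linear_onD(1)] ricci_form_linear(2)[THEN linear_onD(2)]
  by (auto intro!: ip_eqI simp: Ric_ip ip_simps)

text \<open>In an orthonormal basis, the trace of \<open>Ric \<circ> E\<close> is one quarter of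
  \<open>\<Sum> \<langle>[a, b], E [a, b] - [E a, b] - [a, E b]\<rangle>\<close>, in which the second entry vanishes for a derivation.\<close>

lemma trace_Ric_derivation:
  assumes D: "derivation_on V br D"
  shows "trace_on V (\<lambda>x. Ric (D x)) = 0"
proof -
  have DV: "x \<in> V \<Longrightarrow> D x \<in> V" and Dl: "linear_on V D"
    and Dbr: "x \<in> V \<Longrightarrow> y \<in> V \<Longrightarrow> D (br x y) = br (D x) y + br x (D y)" for x y
    using D by (auto simp: derivation_on_def)
  obtain B where B: "orthonormal_basis V ip B" using orthonormal_basis_exists by blast
  note bV = orthonormal_basisD(3)[OF B order.refl]
  have "trace_on V (\<lambda>x. Ric (D x)) = (\<Sum>k\<in>B. ip (Ric (D k)) k)"
    using Ric_linear Dl DV Ric_ip by (intro trace_on_onb[OF B]) (auto simp: linear_on_def)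
  also have "\<dots> = (\<Sum>k\<in>B. (\<Sum>a\<in>B. \<Sum>b\<in>B. ip (br a b) (D k) * ip (br a b) k) / 4
      - (\<Sum>a\<in>B. ip (br (D k) a) (br k a)) / 2)"
    using DV bV by (intro sum.cong refl) (simp add: Ric_ip ricci_form_eq[OF B])
  also have "\<dots> = (\<Sum>k\<in>B. \<Sum>a\<in>B. \<Sum>b\<in>B. ip (br a b) (D k) * ip (br a b) k) / 4
      - (\<Sum>k\<in>B. \<Sum>a\<in>B. ip (br (D k) a) (br k a)) / 2"
    by (simp add: sum_subtractf sum_divide_distrib)
  also have "(\<Sum>k\<in>B. \<Sum>a\<in>B. \<Sum>b\<in>B. ip (br a b) (D k) * ip (br a b) k)
      = (\<Sum>a\<in>B. \<Sum>b\<in>B. \<Sum>k\<in>B. ip (br a b) (D k) * ip (br a b) k)"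
    by (subst sum.swap, intro sum.cong refl sum.swap)
  also have "\<dots> = (\<Sum>a\<in>B. \<Sum>b\<in>B. ip (br (D a) b) (br a b) + ip (br (D b) a) (br b a))"
  proof (intro sum.cong refl)
    fix a b assume ab: "a \<in> B" "b \<in> B"
    then have v: "a \<in> V" "b \<in> V" "br a b \<in> V" "D a \<in> V" "D b \<in> V" using bV DV by auto
    have "(\<Sum>k\<in>B. ip (br a b) (D k) * ip (br a b) k) = ip (br a b) (\<Sum>k\<in>B. ip (br a b) k *\<^sub>R D k)"
      using v DV bV by (subst ip_sum(2)) (auto simp: mult.commute)
    also have "(\<Sum>k\<in>B. ip (br a b) k *\<^sub>R D k) = D (\<Sum>k\<in>B. ip (br a b) k *\<^sub>R k)"
      using bV by (intro linear_on_sum[OF Dl subspace_V, symmetric]) auto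
    also have "(\<Sum>k\<in>B. ip (br a b) k *\<^sub>R k) = br a b"
      using onb_expand[OF B order.refl, of "br a b"] v by auto
    also have "ip (br a b) (D (br a b)) = ip (br (D a) b) (br a b) + ip (br a (D b)) (br a b)"
      using v by (simp add: Dbr ip_simps ip_sym[of "br a b"])
    also have "ip (br a (D b)) (br a b) = ip (br (D b) a) (br b a)"
      using v br_anti[of a b] br_anti[of a "D b"] by (simp add: ip_neg)
    finally show "(\<Sum>k\<in>B. ip (br a b) (D k) * ip (br a b) k)
      = ip (br (D a) b) (br a b) + ip (br (D b) a) (br b a)" .
  qed
  also have "\<dots> = (\<Sum>a\<in>B. \<Sum>b\<in>B. ip (br (D a) b) (br a b)) + (\<Sum>b\<in>B. \<Sum>a\<in>B. ip (br (D b) a) (br b a))"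
    by (simp add: sum.distrib) (rule sum.swap)
  finally show ?thesis by simp
qed

text \<open>The same expression for the operator \<open>E\<close> that scales each basis vector \<open>k\<close> by \<open>g k\<close>: every structure
  constant contributes with the amount by which the bracket raises the weight.\<close>

lemma weighted_ricci_sum:
  assumes B: "orthonormal_basis V ip B"
  shows "(\<Sum>k\<in>B. g k * ricci_form V br ip k k)
    = (\<Sum>k\<in>B. \<Sum>a\<in>B. \<Sum>b\<in>B. (ip (br a b) k)\<^sup>2 * (g k - g a - g b)) / 4"
proof -
  note bV = orthonormal_basisD(3)[OF B order.refl]
  define c where "c a b k = (ip (br a b) k)\<^sup>2" for a b k
  have csym: "c b a k = c a b k" if "a \<in> B" "b \<in> B" "k \<in> B" for a b k
    using that bV br_anti[of a b] by (simp add: c_def ip_neg)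
  have "(\<Sum>k\<in>B. g k * ricci_form V br ip k k)
      = (\<Sum>k\<in>B. (\<Sum>a\<in>B. \<Sum>b\<in>B. c a b k * g k) / 4 - (\<Sum>a\<in>B. \<Sum>b\<in>B. c k a b * g k) / 2)"
  proof (intro sum.cong refl)
    fix k assume k: "k \<in> B"
    have "ip (br k a) (br k a) = (\<Sum>b\<in>B. c k a b)" if a: "a \<in> B" for a
    proof -
      have "ip (br k a) (br k a) = (\<Sum>b\<in>B. ip (br k a) b * ip b (br k a))"
        using a k bV by (intro parseval[OF B]) auto
      also have "\<dots> = (\<Sum>b\<in>B. c k a b)"
        using a k bV by (intro sum.cong refl) (simp add: c_def power2_eq_square ip_sym[of _ "br k a"])
      finally show ?thesis .
    qed
    then show "g k * ricci_form V br ip k k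
      = (\<Sum>a\<in>B. \<Sum>b\<in>B. c a b k * g k) / 4 - (\<Sum>a\<in>B. \<Sum>b\<in>B. c k a b * g k) / 2"
      using k bV by (simp add: ricci_form_eq[OF B] c_def power2_eq_square sum_distrib_left
        sum_distrib_right sum_divide_distrib algebra_simps)
  qed
  also have "\<dots> = (\<Sum>k\<in>B. \<Sum>a\<in>B. \<Sum>b\<in>B. c a b k * g k) / 4
      - (\<Sum>k\<in>B. \<Sum>a\<in>B. \<Sum>b\<in>B. c k a b * g k) / 2"
    by (simp add: sum_subtractf sum_divide_distrib)
  also have e: "(\<Sum>k\<in>B. \<Sum>a\<in>B. \<Sum>b\<in>B. c k a b * g k) = (\<Sum>k\<in>B. \<Sum>a\<in>B. \<Sum>b\<in>B. c a b k * g a)"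
    by (subst (2) sum.swap, intro sum.cong refl sum.swap)
  also have "(\<Sum>k\<in>B. \<Sum>a\<in>B. \<Sum>b\<in>B. c a b k * g a)
      = ((\<Sum>k\<in>B. \<Sum>a\<in>B. \<Sum>b\<in>B. c a b k * g a) + (\<Sum>k\<in>B. \<Sum>a\<in>B. \<Sum>b\<in>B. c a b k * g b)) / 2"
  proof -
    have "(\<Sum>k\<in>B. \<Sum>a\<in>B. \<Sum>b\<in>B. c a b k * g b) = (\<Sum>k\<in>B. \<Sum>b\<in>B. \<Sum>a\<in>B. c a b k * g b)"
      by (intro sum.cong refl sum.swap)
    also have "\<dots> = (\<Sum>k\<in>B. \<Sum>a\<in>B. \<Sum>b\<in>B. c a b k * g a)"
      by (intro sum.cong refl) (simp add: csym)
    finally show ?thesis by simp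
  qed
  finally have "(\<Sum>k\<in>B. g k * ricci_form V br ip k k)
    = ((\<Sum>k\<in>B. \<Sum>a\<in>B. \<Sum>b\<in>B. c a b k * g k) - (\<Sum>k\<in>B. \<Sum>a\<in>B. \<Sum>b\<in>B. c a b k * g a)
      - (\<Sum>k\<in>B. \<Sum>a\<in>B. \<Sum>b\<in>B. c a b k * g b)) / 4" by (simp only: diff_divide_distrib add_divide_distrib)
  then show ?thesis
    by (simp only: c_def sum_subtractf right_diff_distrib)
qed

text \<open>All weights equal to one: each bracket then lowers the total weight by one.\<close>

lemma trace_Ric_neg:
  assumes "bracket_span br V V \<noteq> {0}"
  shows "trace_on V Ric < 0"
proof -
  obtain B where B: "orthonormal_basis V ip B" using orthonormal_basis_exists by blast
  note bV = orthonormal_basisD(3)[OF B order.refl]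
  have "trace_on V Ric = (\<Sum>k\<in>B. ip (Ric k) k)"
    using Ric_linear Ric_ip by (intro trace_on_onb[OF B]) auto
  also have "\<dots> = (\<Sum>k\<in>B. 1 * ricci_form V br ip k k)"
    using bV by (intro sum.cong refl) (simp add: Ric_ip)
  also have "\<dots> = - (\<Sum>k\<in>B. \<Sum>a\<in>B. \<Sum>b\<in>B. (ip (br a b) k)\<^sup>2) / 4"
    by (subst weighted_ricci_sum[OF B]) (simp add: sum_negf)
  finally have eq: "trace_on V Ric = - (\<Sum>k\<in>B. \<Sum>a\<in>B. \<Sum>b\<in>B. (ip (br a b) k)\<^sup>2) / 4" .
  have "\<exists>k\<in>B. \<exists>a\<in>B. \<exists>b\<in>B. ip (br a b) k \<noteq> 0"
  proof (rule ccontr)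
    assume "\<not> ?thesis"
    then have z: "ip (br a b) k = 0" if "a \<in> B" "b \<in> B" "k \<in> B" for a b k using that by auto
    have z1: "br a b = 0" if "a \<in> B" "b \<in> B" for a b
      using onb_expand[OF B order.refl, of "br a b"] z that bV by auto
    have z2: "br a y = 0" if "a \<in> B" "y \<in> V" for a y
      using linear_on_sum[OF br_linear(1) subspace_V, of a B "\<lambda>b. b" "ip y"] z1 that bV
        onb_expand[OF B order.refl, of y] by auto
    have "br x y = 0" if "x \<in> V" "y \<in> V" for x y
      using linear_on_sum[OF br_linear(2) subspace_V, of y B "\<lambda>b. b" "ip x"] z2 that bV
        onb_expand[OF B order.refl, of x] by auto
    then have "{br x y |x y. x \<in> V \<and> y \<in> V} \<subseteq> {0}" by auto
    then have "bracket_span br V V \<subseteq> {0}" unfolding bracket_span_def by (intro span_minimal) auto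
    moreover have "0 \<in> bracket_span br V V" unfolding bracket_span_def by (rule span_zero)
    ultimately show False using assms by auto
  qed
  then obtain k a b where kab: "k \<in> B" "a \<in> B" "b \<in> B" "ip (br a b) k \<noteq> 0" by blast
  have fB: "finite B" using orthonormal_basisD[OF B] by auto
  have "0 < (\<Sum>k\<in>B. \<Sum>a\<in>B. \<Sum>b\<in>B. (ip (br a b) k)\<^sup>2)"
    using kab fB by (intro sum_pos2[of B k] sum_pos2[of B a] sum_pos2[of B b] sum_nonneg) auto
  then show ?thesis using eq by simp
qed

text \<open>Weights \<open>2\<close> on \<open>[W, W]\<close>, \<open>1\<close> on the rest of \<open>W\<close> and \<open>0\<close> on its orthogonal complement. The bracket never
  lowers the total weight: it maps into \<open>W\<close>, it maps two elements of \<open>W\<close> into \<open>[W, W]\<close>, and \<open>[W, W]\<close> is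
  central. It raises the weight as soon as two vectors orthogonal to \<open>W\<close> do not commute, and if all of
  them did, \<open>[V, W]\<close> would contain every bracket.\<close>

lemma trace_Ric_filtration_pos:
  assumes W: "subspace W" "W \<subseteq> V" "bracket_span br V V \<subseteq> W"
    and U: "U = bracket_span br W W"
    and RW: "Ric ` W \<subseteq> W" and RU: "Ric ` U \<subseteq> U"
    and strict: "\<not> bracket_span br V V \<subseteq> bracket_span br V W"
  shows "trace_on W Ric + trace_on U Ric > 0"
proof -
  have UW: "subspace U" "U \<subseteq> W" "U \<subseteq> bracket_span br V V"
  proof -
    show "subspace U" using derived_subspace U by simp
    show "U \<subseteq> bracket_span br V V" unfolding U bracket_span_def using W by (intro span_mono) auto
    then show "U \<subseteq> W" using W by auto
  qed
  obtain B where B: "orthonormal_basis V ip B" "orthonormal_basis W ip (B \<inter> W)"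
      "orthonormal_basis U ip (B \<inter> U)"
    using adapted_orthonormal_basis[OF UW(1,2) W(1,2)] by auto
  note bV = orthonormal_basisD(3)[OF B(1) order.refl]
  have fB: "finite B" using orthonormal_basisD[OF B(1)] by auto
  have UV: "U \<subseteq> V" using UW W by auto
  define g :: "'a \<Rightarrow> real" where "g k = (if k \<in> W then 1 else 0) + (if k \<in> U then 1 else 0)" for k
  have "linear_on W Ric" "linear_on U Ric"
    using Ric_linear W UV by (auto simp: linear_on_def subset_iff)
  then have "trace_on W Ric + trace_on U Ric = (\<Sum>k\<in>B\<inter>W. ip (Ric k) k) + (\<Sum>k\<in>B\<inter>U. ip (Ric k) k)"
    using trace_on_onb[OF B(2)] trace_on_onb[OF B(3)] W UV RW RU by auto
  also have "\<dots> = (\<Sum>k\<in>B. g k * ricci_form V br ip k k)"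
    using fB bV by (simp add: g_def distrib_right sum.distrib sum.inter_restrict Ric_ip
        flip: if_distrib cong: if_cong) (auto simp: Ric_ip bV intro!: arg_cong2[of _ _ _ _ "(+)"] sum.cong)
  also have "\<dots> = (\<Sum>k\<in>B. \<Sum>a\<in>B. \<Sum>b\<in>B. (ip (br a b) k)\<^sup>2 * (g k - g a - g b)) / 4"
    by (rule weighted_ricci_sum[OF B(1)])
  finally have eq: "trace_on W Ric + trace_on U Ric
    = (\<Sum>k\<in>B. \<Sum>a\<in>B. \<Sum>b\<in>B. (ip (br a b) k)\<^sup>2 * (g k - g a - g b)) / 4" .
  have gW: "k \<in> W" if "a \<in> B" "b \<in> B" "k \<in> B" "ip (br a b) k \<noteq> 0" for a b k
  proof (rule ccontr)
    assume "k \<notin> W"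
    moreover have "br a b \<in> W" using br_in_derived[of a V b V] bV that W by auto
    ultimately show False using onb_orthogonal[OF B(1,2) W(2), of "br a b" k] that by auto
  qed
  have nonneg: "0 \<le> (ip (br a b) k)\<^sup>2 * (g k - g a - g b)" if "a \<in> B" "b \<in> B" "k \<in> B" for a b k
  proof (cases "ip (br a b) k = 0")
    case False
    have kW: "k \<in> W" using gW that False by auto
    have aU: "a \<notin> U"
    proof
      assume "a \<in> U"
      then have "br a b = 0" using br_derived UW that bV by auto
      then show False using False ip_zero bV that by auto
    qed
    have bU: "b \<notin> U"
    proof
      assume "b \<in> U"
      then have "br b a = 0" using br_derived UW that bV by auto
      then have "br a b = 0" using br_anti[of b a] that bV by auto
      then show False using False ip_zero bV that by auto
    qed
    have "k \<in> U" if "a \<in> W" "b \<in> W"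
    proof (rule ccontr)
      assume "k \<notin> U"
      moreover have "br a b \<in> U" using br_in_derived[of a W b W] that U by auto
      ultimately show False
        using onb_orthogonal[OF B(1,3) UV, of "br a b" k] False \<open>k \<in> B\<close> by auto
    qed
    then have "g k - g a - g b \<ge> 0" using kW aU bU by (auto simp: g_def)
    then show ?thesis by simp
  qed auto
  have "\<exists>a\<in>B-W. \<exists>b\<in>B-W. br a b \<noteq> 0"
  proof (rule ccontr)
    assume "\<not> ?thesis"
    then have z: "br a b = 0" if "a \<in> B - W" "b \<in> B - W" for a b using that by auto
    define T where "T = bracket_span br V W"
    have T: "subspace T" unfolding T_def by (rule derived_subspace)
    have t1: "br a b \<in> T" if "a \<in> B" "b \<in> B" for a b
    proof (cases "b \<in> W")
      case True
      then show ?thesis unfolding T_def using br_in_derived[of a V b W] bV that by auto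
    next
      case bW: False
      show ?thesis
      proof (cases "a \<in> W")
        case True
        then have "br b a \<in> T" unfolding T_def using br_in_derived[of b V a W] bV that by auto
        then show ?thesis using br_anti[of b a] that bV subspace_neg[OF T] by auto
      next
        case False
        then show ?thesis using z[of a b] that bW subspace_0[OF T] by auto
      qed
    qed
    have t2: "br a y \<in> T" if "a \<in> B" "y \<in> V" for a y
    proof -
      have "br a y = (\<Sum>b\<in>B. ip y b *\<^sub>R br a b)"
        using linear_on_sum[OF br_linear(1) subspace_V, of a B "\<lambda>b. b" "ip y"] that bV
          onb_expand[OF B(1) order.refl, of y] by auto
      then show ?thesis using t1 that T by (simp add: subspace_sum subspace_scale)
    qed
    have t3: "br x y \<in> T" if "x \<in> V" "y \<in> V" for x y
    proof -
      have "br x y = (\<Sum>b\<in>B. ip x b *\<^sub>R br b y)"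
        using linear_on_sum[OF br_linear(2) subspace_V, of y B "\<lambda>b. b" "ip x"] that bV
          onb_expand[OF B(1) order.refl, of x] by auto
      then show ?thesis using t2 that T by (simp add: subspace_sum subspace_scale)
    qed
    then have "bracket_span br V V \<subseteq> T" unfolding bracket_span_def by (intro span_minimal T) auto
    then show False using strict T_def by auto
  qed
  then obtain a b where ab: "a \<in> B - W" "b \<in> B - W" "br a b \<noteq> 0" by blast
  have "\<exists>k\<in>B. ip (br a b) k \<noteq> 0"
  proof (rule ccontr)
    assume "\<not> ?thesis"
    then have "br a b = 0" using onb_expand[OF B(1) order.refl, of "br a b"] ab bV by auto
    then show False using ab by simp
  qed
  then obtain k where k: "k \<in> B" "ip (br a b) k \<noteq> 0" by blast
  have "k \<in> W" using gW ab k by auto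
  then have "g k \<ge> 1" "g a = 0" "g b = 0" using ab UW(2) by (auto simp: g_def)
  then have "0 < (ip (br a b) k)\<^sup>2 * (g k - g a - g b)" using k by (intro mult_pos_pos) auto
  then have "0 < (\<Sum>k\<in>B. \<Sum>a\<in>B. \<Sum>b\<in>B. (ip (br a b) k)\<^sup>2 * (g k - g a - g b))"
    using ab k fB nonneg
    by (intro sum_pos2[of B k] sum_pos2[of B a] sum_pos2[of B b] sum_nonneg) auto
  then show ?thesis using eq by simp
qed

end

section \<open>Coordinate subspaces\<close>

definition bvec :: "nat \<Rightarrow> (nat \<Rightarrow>\<^sub>0 real)" where
  "bvec k = Poly_Mapping.single k 1"

abbreviation coord :: "(nat \<Rightarrow>\<^sub>0 real) \<Rightarrow> nat \<Rightarrow> real" where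
  "coord \<equiv> Poly_Mapping.lookup"

lemma coord_bvec: "coord (bvec k) l = (if k = l then 1 else 0)"
  by (simp add: bvec_def lookup_single when_def)

lemma coord_scaleR: "coord (c *\<^sub>R x) k = c * coord x k"
proof -
  have "finite {i. c *\<^sub>R coord x i \<noteq> 0}"
    by (rule finite_subset[OF _ finite_lookup[of x]]) auto
  then show ?thesis by (simp add: scaleR_poly_mapping_def)
qed

lemmas coord_simps = coord_bvec coord_scaleR lookup_add lookup_minus lookup_uminus lookup_sum

definition coord_space :: "nat set \<Rightarrow> (nat \<Rightarrow>\<^sub>0 real) set" where
  "coord_space K = span (bvec ` K)"

lemma subspace_coord_space: "subspace (coord_space K)"
  by (simp add: coord_space_def)

lemma inj_bvec: "inj bvec"
proof (rule injI)
  fix k l assume "bvec k = bvec l"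
  then have "coord (bvec k) l = 1" by (simp add: coord_bvec)
  then show "k = l" by (auto simp: coord_bvec split: if_splits)
qed

lemma coord_sum_bvec: "finite K \<Longrightarrow> coord (\<Sum>k\<in>K. c k *\<^sub>R bvec k) l = (if l \<in> K then c l else 0)"
  by (simp add: coord_simps if_distrib[of "\<lambda>x. _ * x"] cong: if_cong)

lemma coord_space_expand:
  assumes "finite K" "\<And>k. coord x k \<noteq> 0 \<Longrightarrow> k \<in> K"
  shows "x = (\<Sum>k\<in>K. coord x k *\<^sub>R bvec k)"
  by (rule poly_mapping_eqI) (use assms coord_sum_bvec[of K "coord x"] in auto)

lemma mem_coord_space:
  assumes "finite K"
  shows "x \<in> coord_space K \<longleftrightarrow> (\<forall>k. coord x k \<noteq> 0 \<longrightarrow> k \<in> K)"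
proof
  have "coord_space K \<subseteq> {x. \<forall>k. k \<notin> K \<longrightarrow> coord x k = 0}"
    unfolding coord_space_def
    by (rule span_minimal) (auto simp: coord_simps subspace_def)
  then show "x \<in> coord_space K \<Longrightarrow> \<forall>k. coord x k \<noteq> 0 \<longrightarrow> k \<in> K" by auto
next
  assume "\<forall>k. coord x k \<noteq> 0 \<longrightarrow> k \<in> K"
  then have "x = (\<Sum>k\<in>K. coord x k *\<^sub>R bvec k)" using assms by (intro coord_space_expand) auto
  also have "\<dots> \<in> coord_space K"
    unfolding coord_space_def by (intro span_sum span_scale span_base) auto
  finally show "x \<in> coord_space K" .
qed

lemma bvec_in_coord_space: "k \<in> K \<Longrightarrow> bvec k \<in> coord_space K"
  unfolding coord_space_def by (auto intro: span_base)

lemma independent_bvec: "finite K \<Longrightarrow> independent (bvec ` K)"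
proof (rule independent_if_scalars_zero)
  fix f x assume K: "finite K" and s: "(\<Sum>x\<in>bvec ` K. f x *\<^sub>R x) = 0" and "x \<in> bvec ` K"
  then obtain k where k: "k \<in> K" "x = bvec k" by auto
  have "(\<Sum>k\<in>K. f (bvec k) *\<^sub>R bvec k) = 0"
    using s inj_bvec by (simp add: sum.reindex inj_on_def)
  then have "coord (\<Sum>k\<in>K. f (bvec k) *\<^sub>R bvec k) k = 0" by simp
  then show "f x = 0" using k K coord_sum_bvec[of K "\<lambda>k. f (bvec k)" k] by simp
qed auto

lemma dim_coord_space: "finite K \<Longrightarrow> dim (coord_space K) = card K"
  unfolding coord_space_def
  using independent_bvec dim_span_eq_card_independent card_image[of bvec K] inj_bvec
  by (metis inj_on_subset subset_UNIV)

lemma coord_space_linear_image: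
  assumes K: "finite K" and f: "linear_on V f" and sub: "subspace V" "coord_space K \<subseteq> V"
    and T: "subspace T" and b: "\<And>k. k \<in> K \<Longrightarrow> f (bvec k) \<in> T"
  shows "f ` coord_space K \<subseteq> T"
proof
  fix y assume "y \<in> f ` coord_space K"
  then obtain x where x: "x \<in> coord_space K" "y = f x" by auto
  then have e: "x = (\<Sum>k\<in>K. coord x k *\<^sub>R bvec k)"
    using K by (intro coord_space_expand) (auto simp: mem_coord_space)
  have "f (\<Sum>k\<in>K. coord x k *\<^sub>R bvec k) = (\<Sum>k\<in>K. coord x k *\<^sub>R f (bvec k))"
    using sub bvec_in_coord_space by (intro linear_on_sum[OF f]) auto
  also have "\<dots> \<in> T" using b by (intro subspace_sum subspace_scale T) auto
  finally show "y \<in> T" using x e by simp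
qed

lemma trace_coord_space:
  assumes K: "finite K" and f: "linear_on (coord_space K) f" "f ` coord_space K \<subseteq> coord_space K"
  shows "trace_on (coord_space K) f = (\<Sum>k\<in>K. coord (f (bvec k)) k)"
proof -
  have rep: "representation (bvec ` K) x (bvec k) = coord x k" if "x \<in> coord_space K" "k \<in> K" for x k
  proof -
    have "x = (\<Sum>b\<in>bvec ` K. representation (bvec ` K) x b *\<^sub>R b)"
      using real_vector.sum_representation_eq[of "bvec ` K" x "bvec ` K"] K independent_bvec that
      by (auto simp: coord_space_def)
    also have "\<dots> = (\<Sum>k\<in>K. representation (bvec ` K) x (bvec k) *\<^sub>R bvec k)"
      using inj_bvec by (simp add: sum.reindex inj_on_def)
    finally show ?thesis
      using coord_sum_bvec[OF K, of "\<lambda>k. representation (bvec ` K) x (bvec k)" k] that by simp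
  qed
  have "trace_on (coord_space K) f = (\<Sum>b\<in>bvec ` K. representation (bvec ` K) (f b) b)"
    using K f independent_bvec by (intro trace_on_basis) (auto simp: coord_space_def)
  also have "\<dots> = (\<Sum>k\<in>K. representation (bvec ` K) (f (bvec k)) (bvec k))"
    using inj_bvec by (subst sum.reindex) (auto simp: inj_on_def)
  also have "\<dots> = (\<Sum>k\<in>K. coord (f (bvec k)) k)"
    using f bvec_in_coord_space by (intro sum.cong refl rep) auto
  finally show ?thesis .
qed

text \<open>Coordinates are labelled by pairs of numbers: \<open>(v, v)\<close> stands for the vertex \<open>v\<close>, and \<open>(u, v)\<close> with
  \<open>u < v\<close> for the edge between \<open>u\<close> and \<open>v\<close>. The basis of a graph algebra is then indexed by the graph
  itself, without an enumeration of its edges.\<close>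

definition pairs_space :: "(nat \<times> nat) set \<Rightarrow> (nat \<Rightarrow>\<^sub>0 real) set" where
  "pairs_space P = coord_space (prod_encode ` P)"

abbreviation unit_vec :: "nat \<times> nat \<Rightarrow> (nat \<Rightarrow>\<^sub>0 real)" where
  "unit_vec e \<equiv> bvec (prod_encode e)"

abbreviation crd :: "(nat \<Rightarrow>\<^sub>0 real) \<Rightarrow> nat \<times> nat \<Rightarrow> real" where
  "crd x e \<equiv> coord x (prod_encode e)"

lemma crd_vec: "crd (unit_vec e) e' = (if e = e' then 1 else 0)"
  by (auto simp: coord_bvec prod_encode_eq)

lemma crd_eqI: "(\<And>e. crd x e = crd y e) \<Longrightarrow> x = y"
  by (rule poly_mapping_eqI) (metis prod_decode_inverse)

lemma mem_pairs_space: "finite P \<Longrightarrow> x \<in> pairs_space P \<longleftrightarrow> (\<forall>e. crd x e \<noteq> 0 \<longrightarrow> e \<in> P)"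
  unfolding pairs_space_def
  by (subst mem_coord_space, simp)
     (metis (no_types, lifting) image_eqI image_iff prod_decode_inverse prod_encode_inverse)

lemma vec_in_pairs_space: "e \<in> P \<Longrightarrow> unit_vec e \<in> pairs_space P"
  unfolding pairs_space_def by (auto intro: bvec_in_coord_space)

lemma pairs_space_minimal: "subspace T \<Longrightarrow> (\<And>e. e \<in> P \<Longrightarrow> unit_vec e \<in> T) \<Longrightarrow> pairs_space P \<subseteq> T"
  unfolding pairs_space_def coord_space_def by (intro span_minimal) auto

lemma subspace_pairs_space: "subspace (pairs_space P)"
  by (simp add: pairs_space_def subspace_coord_space)

lemma dim_pairs_space: "finite P \<Longrightarrow> dim (pairs_space P) = card P"
  by (simp add: pairs_space_def dim_coord_space card_image[OF inj_prod_encode])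

lemma trace_pairs_space:
  assumes "finite P" "linear_on (pairs_space P) f" "f ` pairs_space P \<subseteq> pairs_space P"
  shows "trace_on (pairs_space P) f = (\<Sum>e\<in>P. crd (f (unit_vec e)) e)"
proof -
  have "trace_on (pairs_space P) f = (\<Sum>k\<in>prod_encode ` P. coord (f (bvec k)) k)"
    unfolding pairs_space_def using assms by (intro trace_coord_space) (auto simp: pairs_space_def)
  also have "\<dots> = (\<Sum>e\<in>P. crd (f (unit_vec e)) e)"
    by (subst sum.reindex) (auto simp: inj_prod_encode)
  finally show ?thesis .
qed

section \<open>Graph Lie algebras\<close>

definition graph_bracket ::
    "(nat \<times> nat) set \<Rightarrow> (nat \<Rightarrow>\<^sub>0 real) \<Rightarrow> (nat \<Rightarrow>\<^sub>0 real) \<Rightarrow> (nat \<Rightarrow>\<^sub>0 real)" where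
  "graph_bracket E x y =
    (\<Sum>(u,v)\<in>E. (crd x (u,u) * crd y (v,v) - crd x (v,v) * crd y (u,u)) *\<^sub>R unit_vec (u,v))"

definition vertex_pairs :: "nat set \<Rightarrow> (nat \<times> nat) set" where
  "vertex_pairs S = (\<lambda>v. (v, v)) ` S"

definition graph_space :: "nat \<Rightarrow> (nat \<times> nat) set \<Rightarrow> (nat \<Rightarrow>\<^sub>0 real) set" where
  "graph_space q E = pairs_space (vertex_pairs {..<q} \<union> E)"

locale ordered_graph =
  fixes q :: nat and E :: "(nat \<times> nat) set"
  assumes E_less: "(u, v) \<in> E \<Longrightarrow> u < v" and E_q: "(u, v) \<in> E \<Longrightarrow> v < q"
begin

definition adj :: "nat \<Rightarrow> nat \<Rightarrow> bool" where "adj u v \<longleftrightarrow> (u, v) \<in> E \<or> (v, u) \<in> E"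

abbreviation "br \<equiv> graph_bracket E"
abbreviation "V \<equiv> graph_space q E"

lemma finite_E: "finite E"
  by (rule finite_subset[of _ "{..<q} \<times> {..<q}"]) (use E_less E_q in \<open>force+\<close>)

lemma E_lt: "(u, v) \<in> E \<Longrightarrow> u < q"
  using E_less E_q by (meson less_trans)

lemma diag_notin_E: "(v, v) \<notin> E"
  using E_less by blast

lemma finite_P: "finite S \<Longrightarrow> finite (vertex_pairs S \<union> E)"
  by (simp add: vertex_pairs_def finite_E)

lemma vertex_pairs_disjoint: "vertex_pairs S \<inter> E = {}"
  using diag_notin_E by (auto simp: vertex_pairs_def)

lemma mem_V: "x \<in> V \<longleftrightarrow> (\<forall>e. crd x e \<noteq> 0 \<longrightarrow> e \<in> vertex_pairs {..<q} \<union> E)"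
  unfolding graph_space_def by (rule mem_pairs_space, rule finite_P) simp

lemma crd_br: "crd (br x y) e = (if e \<in> E then crd x (fst e, fst e) * crd y (snd e, snd e)
    - crd x (snd e, snd e) * crd y (fst e, fst e) else 0)"
proof -
  have "crd (br x y) e = (\<Sum>e'\<in>E. if e' = e then crd x (fst e, fst e) * crd y (snd e, snd e)
    - crd x (snd e, snd e) * crd y (fst e, fst e) else 0)"
    unfolding graph_bracket_def lookup_sum
    by (intro sum.cong refl) (auto simp: coord_scaleR crd_vec)
  then show ?thesis by (simp add: finite_E)
qed

lemma crd_br_vertex: "crd (br x y) (v, v) = 0"
  by (simp add: crd_br diag_notin_E)

lemma vec_vertex_in_V: "v < q \<Longrightarrow> unit_vec (v, v) \<in> V"
  unfolding graph_space_def by (rule vec_in_pairs_space) (simp add: vertex_pairs_def)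

lemma vec_edge_in_V: "e \<in> E \<Longrightarrow> unit_vec e \<in> V"
  unfolding graph_space_def by (rule vec_in_pairs_space) simp

lemma br_in_V: "br x y \<in> V"
  by (auto simp: mem_V crd_br split: if_splits)

lemma subspace_V: "subspace V"
  by (simp add: graph_space_def subspace_pairs_space)

lemma br_vertices: "(u, v) \<in> E \<Longrightarrow> br (unit_vec (u,u)) (unit_vec (v,v)) = unit_vec (u,v)"
proof (rule crd_eqI)
  fix e assume uv: "(u, v) \<in> E"
  have "u \<noteq> v" "(v, u) \<notin> E" using E_less[OF uv] E_less[of v u] by auto
  then show "crd (br (unit_vec (u,u)) (unit_vec (v,v))) e = crd (unit_vec (u,v)) e"
    using uv by (cases e) (auto simp: crd_br crd_vec)
qed

lemma br_br: "br x (br y z) = 0"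
  by (intro crd_eqI) (auto simp: crd_br crd_br_vertex)

lemma lie_algebra_V: "lie_algebra V br"
  unfolding lie_algebra_def bilinear_on_def linear_on_def
proof (intro conjI ballI allI)
  show "fin_dim_subspace V"
    unfolding fin_dim_subspace_def graph_space_def pairs_space_def coord_space_def
    using finite_P by (intro exI[of _ "bvec ` prod_encode ` (vertex_pairs {..<q} \<union> E)"]) auto
qed (auto simp: br_in_V br_br intro!: crd_eqI simp: crd_br lookup_add coord_scaleR algebra_simps)

text \<open>With all vertices in \<open>S\<close> this is the derived algebra; with the non-hubs in \<open>S\<close> it is the last step of
  the filtration \<open>V \<supseteq> W \<supseteq> [W, W]\<close>.\<close>

lemma bracket_span_vertex_pairs:
  assumes S: "S \<subseteq> {..<q}"
  shows "bracket_span br (pairs_space (vertex_pairs S \<union> E)) (pairs_space (vertex_pairs S \<union> E))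
    = pairs_space {(u,v)\<in>E. u \<in> S \<and> v \<in> S}" (is "bracket_span br ?W ?W = pairs_space ?U")
proof
  have fS: "finite S" using S finite_subset by blast
  have fU: "finite ?U" using finite_E by (rule rev_finite_subset) auto
  have zero: "crd x (v, v) = 0" if "x \<in> ?W" "v \<notin> S" for x v
    using that mem_pairs_space[OF finite_P[OF fS]] diag_notin_E by (fastforce simp: vertex_pairs_def)
  show "bracket_span br ?W ?W \<subseteq> pairs_space ?U"
    unfolding bracket_span_def
  proof (rule span_minimal[OF _ subspace_pairs_space], clarify)
    fix x y assume xy: "x \<in> ?W" "y \<in> ?W"
    show "br x y \<in> pairs_space ?U"
      unfolding mem_pairs_space[OF fU]
    proof (intro allI impI)
      fix e assume ne: "crd (br x y) e \<noteq> 0"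
      obtain a b where ab: "e = (a,b)" by (cases e)
      show "e \<in> ?U"
        using ne ab zero[OF xy(1), of a] zero[OF xy(2), of a] zero[OF xy(1), of b] zero[OF xy(2), of b]
        by (cases "a \<in> S"; cases "b \<in> S") (auto simp: crd_br split: if_splits)
    qed
  qed
  show "pairs_space ?U \<subseteq> bracket_span br ?W ?W"
  proof (rule pairs_space_minimal)
    show "subspace (bracket_span br ?W ?W)" by (simp add: bracket_span_def)
    fix e assume "e \<in> ?U"
    then obtain u v where e: "e = (u,v)" "(u,v) \<in> E" "u \<in> S" "v \<in> S" by auto
    then have "unit_vec (u,u) \<in> ?W" "unit_vec (v,v) \<in> ?W"
      by (auto intro!: vec_in_pairs_space simp: vertex_pairs_def)
    then have "br (unit_vec (u,u)) (unit_vec (v,v)) \<in> bracket_span br ?W ?W"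
      unfolding bracket_span_def by (intro span_base) blast
    then show "unit_vec e \<in> bracket_span br ?W ?W" using br_vertices e by simp
  qed
qed

lemma derived_V: "bracket_span br V V = pairs_space E"
proof -
  have "{(u,v)\<in>E. u \<in> {..<q} \<and> v \<in> {..<q}} = E" using E_q E_lt by auto
  then show ?thesis using bracket_span_vertex_pairs[of "{..<q}"] by (simp add: graph_space_def)
qed

lemma two_step_nilpotent_V: "E \<noteq> {} \<Longrightarrow> two_step_nilpotent V br"
proof -
  assume "E \<noteq> {}"
  then obtain e where e: "e \<in> E" by blast
  have "unit_vec e \<noteq> 0"
  proof
    assume "unit_vec e = 0"
    then have "crd (unit_vec e) e = 0" by simp
    then show False by (simp add: crd_vec)
  qed
  then have "bracket_span br V V \<noteq> {0}" using vec_in_pairs_space[OF e] derived_V by auto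
  moreover have "bracket_span br V (bracket_span br V V) = {0}"
  proof -
    have "br x y = 0" if "y \<in> pairs_space E" for x y
    proof -
      have "crd y (v,v) = 0" for v using that mem_pairs_space[OF finite_E] diag_notin_E by blast
      then show ?thesis by (intro crd_eqI) (auto simp: crd_br)
    qed
    then have "{br x y |x y. x \<in> V \<and> y \<in> bracket_span br V V} \<subseteq> {0}" using derived_V by auto
    then have "bracket_span br V (bracket_span br V V) \<subseteq> {0}"
      unfolding bracket_span_def[of br V "bracket_span br V V"] by (intro span_minimal) auto
    moreover have "0 \<in> bracket_span br V (bracket_span br V V)"
      by (simp add: bracket_span_def span_zero)
    ultimately show ?thesis by auto
  qed
  ultimately show ?thesis by (simp add: two_step_nilpotent_def)
qed

lemma has_type_V: "has_type V br (card E) q"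
proof -
  have "card (vertex_pairs {..<q} \<union> E) = q + card E"
    using vertex_pairs_disjoint finite_E
    by (subst card_Un_disjoint) (auto simp: vertex_pairs_def card_image inj_on_def)
  then show ?thesis
    unfolding has_type_def derived_V unfolding graph_space_def
    using dim_pairs_space[OF finite_P[of "{..<q}"]] dim_pairs_space[OF finite_E] by simp
qed

text \<open>The two summands \<open>I\<close> and \<open>J\<close> commute. At an edge \<open>{u, v}\<close> this makes all coordinate pairs of \<open>I\<close> parallel to
  those of \<open>J\<close>; since together they span the plane, one of the summands vanishes at both ends. They
  cannot both vanish at a vertex, so by connectedness the same summand vanishes at all vertices. It
  lies in the derived algebra, which is contained in the other summand.\<close>

lemma indecomposable_V:
  assumes conn: "\<And>S. S \<subseteq> {..<q} \<Longrightarrow> S \<noteq> {} \<Longrightarrow> S \<noteq> {..<q} \<Longrightarrow> \<exists>(u,v)\<in>E. (u \<in> S) \<noteq> (v \<in> S)"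
    and q: "q \<ge> 2"
  shows "indecomposable V br"
proof -
  have br_sum: "br (x + y) (x' + y') = br x x' + br x y' + br y x' + br y y'" for x y x' y'
    by (intro crd_eqI) (auto simp: crd_br lookup_add algebra_simps)
  \<comment> \<open>A summand without vertex coordinates is central, so the other one contains every bracket.\<close>
  have vanish: "I = {0}"
    if I: "lie_ideal V br I" and J: "lie_ideal V br J" and IJ: "I \<inter> J = {0}"
      and VIJ: "V = {x + y | x y. x \<in> I \<and> y \<in> J}"
      and van: "\<And>x v. x \<in> I \<Longrightarrow> v < q \<Longrightarrow> crd x (v,v) = 0" for I J
  proof -
    have IV: "I \<subseteq> V" and JV: "J \<subseteq> V" and Jsub: "subspace J" and I0: "0 \<in> I"
      using I J subspace_0 by (auto simp: lie_ideal_def)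
    have van': "crd x (v,v) = 0" if "x \<in> I" for x v
    proof (cases "v < q")
      case False
      then show ?thesis using that IV mem_V[of x] diag_notin_E by (auto simp: vertex_pairs_def)
    qed (use van that in auto)
    have b0: "br x y = 0" "br y x = 0" if "x \<in> I" for x y
      using van'[OF that] by (auto intro!: crd_eqI simp: crd_br)
    have "pairs_space E \<subseteq> J"
    proof (rule pairs_space_minimal[OF Jsub])
      fix e assume e: "e \<in> E"
      obtain u v where uv: "e = (u,v)" by (cases e)
      have "unit_vec (u,u) \<in> V" "unit_vec (v,v) \<in> V" using e uv E_q E_lt by (auto intro: vec_vertex_in_V)
      then obtain x y x' y' where d: "unit_vec (u,u) = x + y" "unit_vec (v,v) = x' + y'"
        "x \<in> I" "y \<in> J" "x' \<in> I" "y' \<in> J" unfolding VIJ by blast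
      have "unit_vec e = br y y'" using br_vertices[of u v] e uv d b0 by (simp add: br_sum)
      also have "\<dots> \<in> J" using J d JV by (auto simp: lie_ideal_def)
      finally show "unit_vec e \<in> J" .
    qed
    moreover have "I \<subseteq> pairs_space E"
    proof
      fix x assume x: "x \<in> I"
      show "x \<in> pairs_space E"
        unfolding mem_pairs_space[OF finite_E]
      proof (intro allI impI)
        fix e assume "crd x e \<noteq> 0"
        moreover have "x \<in> V" using x IV by auto
        ultimately show "e \<in> E" using mem_V[of x] van'[OF x] by (cases e) (auto simp: vertex_pairs_def)
      qed
    qed
    ultimately show ?thesis using IJ I0 by auto
  qed
  show ?thesis
    unfolding indecomposable_def
  proof (rule notI, elim exE conjE)
    fix I J
    assume I: "lie_ideal V br I" and J: "lie_ideal V br J" and n: "I \<noteq> {0}" "J \<noteq> {0}"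
      and IJ: "I \<inter> J = {0}" and VIJ: "V = {x + y | x y. x \<in> I \<and> y \<in> J}"
    have IV: "I \<subseteq> V" and JV: "J \<subseteq> V" and Isub: "subspace I"
      using I J by (auto simp: lie_ideal_def)
    have par: "crd x (u,u) * crd y (v,v) = crd x (v,v) * crd y (u,u)"
      if "x \<in> I" "y \<in> J" "(u,v) \<in> E" for x y u v
    proof -
      have "br x y \<in> J" using J that IV by (auto simp: lie_ideal_def)
      moreover have "br y x \<in> I" using I that JV by (auto simp: lie_ideal_def)
      then have "- br y x \<in> I" using subspace_neg[OF Isub] by blast
      moreover have "- br y x = br x y" by (intro crd_eqI) (auto simp: crd_br)
      ultimately have "br x y = 0" using IJ by auto
      then have "crd (br x y) (u,v) = 0" by simp
      then show ?thesis using that by (simp add: crd_br)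
    qed
    have dich: "(\<forall>x\<in>I. crd x (u,u) = 0 \<and> crd x (v,v) = 0) \<or> (\<forall>y\<in>J. crd y (u,u) = 0 \<and> crd y (v,v) = 0)"
      if e: "(u,v) \<in> E" for u v
    proof (rule ccontr)
      assume "\<not> ?thesis"
      then obtain x y where x: "x \<in> I" "crd x (u,u) \<noteq> 0 \<or> crd x (v,v) \<noteq> 0"
        and y: "y \<in> J" "crd y (u,u) \<noteq> 0 \<or> crd y (v,v) \<noteq> 0" by auto
      have xx: "crd x' (u,u) * crd x (v,v) = crd x' (v,v) * crd x (u,u)" if "x' \<in> I" for x'
      proof -
        have 1: "crd x' (u,u) * crd y (v,v) = crd x' (v,v) * crd y (u,u)" using par that y e by blast
        have 2: "crd x (u,u) * crd y (v,v) = crd x (v,v) * crd y (u,u)" using par x y e by blast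
        have "(crd x' (u,u) * crd x (v,v) - crd x' (v,v) * crd x (u,u)) * crd y (v,v) = 0"
          using 1 2 by algebra
        moreover have "(crd x' (u,u) * crd x (v,v) - crd x' (v,v) * crd x (u,u)) * crd y (u,u) = 0"
          using 1 2 by algebra
        ultimately show ?thesis using y by auto
      qed
      have z: "crd z (u,u) * crd x (v,v) = crd z (v,v) * crd x (u,u)" if "z \<in> V" for z
      proof -
        obtain x' y' where xy: "z = x' + y'" "x' \<in> I" "y' \<in> J" using \<open>z \<in> V\<close> unfolding VIJ by blast
        show ?thesis using xx[OF xy(2)] par[OF x(1) xy(3) e] xy(1)
          by (simp add: lookup_add algebra_simps)
      qed
      have "u \<noteq> v" using E_less e by blast
      then show False
        using z[OF vec_vertex_in_V, of u] z[OF vec_vertex_in_V, of v] e E_q E_lt x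
        by (auto simp: crd_vec)
    qed
    have both: "\<not> ((\<forall>x\<in>I. crd x (u,u) = 0) \<and> (\<forall>y\<in>J. crd y (u,u) = 0))" if "u < q" for u
    proof
      assume a: "(\<forall>x\<in>I. crd x (u,u) = 0) \<and> (\<forall>y\<in>J. crd y (u,u) = 0)"
      have "unit_vec (u,u) \<in> V" using that by (rule vec_vertex_in_V)
      then obtain x y where "unit_vec (u,u) = x + y" "x \<in> I" "y \<in> J" unfolding VIJ by blast
      then have "crd (unit_vec (u,u)) (u,u) = 0" using a by (simp add: lookup_add)
      then show False by (simp add: crd_vec)
    qed
    define S where "S = {u. u < q \<and> (\<forall>x\<in>I. crd x (u,u) = 0)}"
    have "(u \<in> S) = (v \<in> S)" if "(u,v) \<in> E" for u v
      using dich[OF that] both[of u] both[of v] E_lt[OF that] E_q[OF that] by (auto simp: S_def)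
    moreover have "S \<subseteq> {..<q}" by (auto simp: S_def)
    ultimately have "S = {} \<or> S = {..<q}" using conn[of S] by blast
    then show False
    proof
      assume "S = {..<q}"
      then have "I = {0}" using IJ VIJ by (intro vanish[OF I J]) (auto simp: S_def)
      then show False using n by simp
    next
      assume S: "S = {}"
      have "crd y (v,v) = 0" if "y \<in> J" "v < q" for y v
      proof -
        have "card {v} \<noteq> card {..<q}" using q by simp
        then have "{v} \<noteq> {..<q}" by metis
        then have "\<exists>(a,b)\<in>E. (a \<in> {v}) \<noteq> (b \<in> {v})" using \<open>v < q\<close> by (intro conn) auto
        then obtain a b where ab: "(a,b) \<in> E" "a = v \<or> b = v" by auto
        have "\<not> (\<forall>x\<in>I. crd x (v,v) = 0)" using S that by (auto simp: S_def)
        then show ?thesis using dich[OF ab(1)] ab(2) that by auto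
      qed
      moreover have "V = {x + y | x y. x \<in> J \<and> y \<in> I}"
        unfolding VIJ by (rule Collect_cong) (metis add.commute)
      ultimately have "J = {0}" using IJ by (intro vanish[OF J I]) auto
      then show False using n by simp
    qed
  qed
qed

definition diag_derivation :: "(nat \<Rightarrow> real) \<Rightarrow> (nat \<Rightarrow>\<^sub>0 real) \<Rightarrow> (nat \<Rightarrow>\<^sub>0 real)" where
  "diag_derivation w x = (\<Sum>v<q. (w v * crd x (v,v)) *\<^sub>R unit_vec (v,v))
     + (\<Sum>(u,v)\<in>E. ((w u + w v) * crd x (u,v)) *\<^sub>R unit_vec (u,v))"

lemma crd_diag_derivation:
  "crd (diag_derivation w x) e = (if e \<in> vertex_pairs {..<q} then w (fst e) * crd x e
     else if e \<in> E then (w (fst e) + w (snd e)) * crd x e else 0)"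
proof -
  have "crd (\<Sum>v<q. (w v * crd x (v,v)) *\<^sub>R unit_vec (v,v)) e
      = (\<Sum>v<q. if v = fst e then (if fst e = snd e then w (fst e) * crd x e else 0) else 0)"
    unfolding lookup_sum by (cases e, intro sum.cong refl) (auto simp: coord_scaleR crd_vec)
  also have "\<dots> = (if e \<in> vertex_pairs {..<q} then w (fst e) * crd x e else 0)"
    by (cases e) (auto simp: vertex_pairs_def)
  finally have 1: "crd (\<Sum>v<q. (w v * crd x (v,v)) *\<^sub>R unit_vec (v,v)) e
    = (if e \<in> vertex_pairs {..<q} then w (fst e) * crd x e else 0)" .
  have "crd (\<Sum>(u,v)\<in>E. ((w u + w v) * crd x (u,v)) *\<^sub>R unit_vec (u,v)) e
      = (\<Sum>e'\<in>E. if e' = e then (w (fst e) + w (snd e)) * crd x e else 0)"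
    unfolding lookup_sum by (intro sum.cong refl) (auto simp: coord_scaleR crd_vec)
  also have "\<dots> = (if e \<in> E then (w (fst e) + w (snd e)) * crd x e else 0)"
    by (simp add: finite_E)
  finally show ?thesis
    unfolding diag_derivation_def lookup_add 1 using vertex_pairs_disjoint by auto
qed

lemma diag_derivation: "derivation_on V br (diag_derivation w)"
  unfolding derivation_on_def linear_on_def
proof (intro conjI ballI allI)
  show "diag_derivation w ` V \<subseteq> V"
    by (auto simp: mem_V crd_diag_derivation split: if_splits)
  fix x y :: "nat \<Rightarrow>\<^sub>0 real"
  show "diag_derivation w (br x y) = br (diag_derivation w x) y + br x (diag_derivation w y)"
  proof (rule crd_eqI)
    fix e
    have "e \<notin> vertex_pairs {..<q}" if "e \<in> E" using vertex_pairs_disjoint that by auto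
    moreover have "(fst e, fst e) \<in> vertex_pairs {..<q}" "(snd e, snd e) \<in> vertex_pairs {..<q}" if "e \<in> E"
      using that E_lt[of "fst e" "snd e"] E_q[of "fst e" "snd e"] by (auto simp: vertex_pairs_def)
    ultimately show "crd (diag_derivation w (br x y)) e
        = crd (br (diag_derivation w x) y + br x (diag_derivation w y)) e"
      by (auto simp: crd_diag_derivation crd_br lookup_add algebra_simps vertex_pairs_def)
  qed
qed (auto intro!: crd_eqI simp: crd_diag_derivation lookup_add coord_scaleR algebra_simps)

lemma diag_derivation_vec:
  "v < q \<Longrightarrow> diag_derivation w (unit_vec (v,v)) = w v *\<^sub>R unit_vec (v,v)"
  "(u,v) \<in> E \<Longrightarrow> diag_derivation w (unit_vec (u,v)) = (w u + w v) *\<^sub>R unit_vec (u,v)"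
  using diag_notin_E
  by (auto intro!: crd_eqI simp: crd_diag_derivation crd_vec coord_scaleR vertex_pairs_def)

text \<open>The diagonal part of any derivation is again a derivation.\<close>

lemma derivation_edge_diagonal:
  assumes D: "derivation_on V br D" and e: "(u,v) \<in> E"
  shows "crd (D (unit_vec (u,v))) (u,v) = crd (D (unit_vec (u,u))) (u,u) + crd (D (unit_vec (v,v))) (v,v)"
proof -
  have "D (br (unit_vec (u,u)) (unit_vec (v,v))) = br (D (unit_vec (u,u))) (unit_vec (v,v)) + br (unit_vec (u,u)) (D (unit_vec (v,v)))"
    using D e E_lt E_q vec_vertex_in_V by (auto simp: derivation_on_def)
  then show ?thesis
    using e E_less[OF e] by (simp add: br_vertices lookup_add crd_br crd_vec)
qed

end

section \<open>The weights of a nilsoliton on a graph algebra\<close>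

context ordered_graph
begin

text \<open>The system \<open>\<xi>\<^sub>v + \<Sum>\<^bsub>u \<sim> v\<^esub> (\<xi>\<^sub>u + \<xi>\<^sub>v) = 1\<close> in weak form, that is, paired with an arbitrary
  \<open>w\<close>. This is the form in which it arises, from the derivation with eigenvalues \<open>w\<close>, and in which
  it is used.\<close>

definition soliton_weights :: "(nat \<Rightarrow> real) \<Rightarrow> bool" where
  "soliton_weights \<xi> \<longleftrightarrow> (\<forall>w. (\<Sum>v<q. w v * \<xi> v) + (\<Sum>(u,v)\<in>E. (w u + w v) * (\<xi> u + \<xi> v)) = (\<Sum>v<q. w v))"

text \<open>By hypothesis, a non-hub \<open>r\<close> commutes with a neighbour \<open>r'\<close> of the hub \<open>h\<close>. By the Leibniz rule, the coordinate of
  \<open>D r\<close> at \<open>h\<close> appears, up to sign, as the coordinate of \<open>D [r, r'] = 0\<close> at the edge \<open>{h, r'}\<close>, where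
  nothing can cancel it.\<close>

lemma derivation_preserves_nonhubs:
  assumes D: "derivation_on V br D"
    and H: "H \<subseteq> {..<q}"
    and far: "\<And>r h. r \<in> {..<q} - H \<Longrightarrow> h \<in> H \<Longrightarrow> \<exists>r'<q. r' \<noteq> r \<and> adj h r' \<and> \<not> adj r r'"
  shows "D ` pairs_space (vertex_pairs ({..<q} - H) \<union> E) \<subseteq> pairs_space (vertex_pairs ({..<q} - H) \<union> E)"
proof -
  define P where "P = vertex_pairs ({..<q} - H) \<union> E"
  have fP: "finite P" unfolding P_def by (rule finite_P) simp
  have DV: "x \<in> V \<Longrightarrow> D x \<in> V" and Dl: "linear_on V D"
    and Dbr: "x \<in> V \<Longrightarrow> y \<in> V \<Longrightarrow> D (br x y) = br (D x) y + br x (D y)" for x y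
    using D by (auto simp: derivation_on_def)
  have PV: "pairs_space P \<subseteq> V"
    unfolding P_def by (rule pairs_space_minimal[OF subspace_V])
      (auto simp: vertex_pairs_def intro: vec_vertex_in_V vec_edge_in_V)
  have img: "D (unit_vec e) \<in> pairs_space P" if e: "e \<in> P" for e
  proof -
    have "unit_vec e \<in> V" using e PV vec_in_pairs_space by blast
    then have inV: "D (unit_vec e) \<in> V" by (rule DV)
    have hub: "crd (D (unit_vec e)) (h,h) = 0" if h: "h \<in> H" for h
    proof (cases "e \<in> E")
      case True
      obtain u v where uv: "e = (u,v)" by (cases e)
      have "D (br (unit_vec (u,u)) (unit_vec (v,v))) = br (D (unit_vec (u,u))) (unit_vec (v,v)) + br (unit_vec (u,u)) (D (unit_vec (v,v)))"
        using True uv E_lt E_q vec_vertex_in_V by (intro Dbr) auto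
      then have "D (unit_vec e) = br (D (unit_vec (u,u))) (unit_vec (v,v)) + br (unit_vec (u,u)) (D (unit_vec (v,v)))"
        using br_vertices True uv by simp
      then show ?thesis by (simp add: lookup_add crd_br_vertex)
    next
      case False
      then obtain r where r: "e = (r,r)" "r \<in> {..<q} - H" using e by (auto simp: P_def vertex_pairs_def)
      obtain r' where r': "r' < q" "r' \<noteq> r" "adj h r'" "\<not> adj r r'" using far[OF r(2) h] by blast
      have "r \<noteq> h" using r h by auto
      have "br (unit_vec (r,r)) (unit_vec (r',r')) = 0"
        using r' by (intro crd_eqI) (auto simp: crd_br crd_vec adj_def)
      moreover have "D 0 = 0" using linear_on_0[OF Dl subspace_V] .
      moreover have "D (br (unit_vec (r,r)) (unit_vec (r',r'))) = br (D (unit_vec (r,r))) (unit_vec (r',r')) + br (unit_vec (r,r)) (D (unit_vec (r',r')))"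
        using r r' vec_vertex_in_V by (intro Dbr) auto
      ultimately have z: "crd (br (D (unit_vec (r,r))) (unit_vec (r',r')) + br (unit_vec (r,r)) (D (unit_vec (r',r')))) f = 0" for f
        by simp
      show ?thesis
      proof (cases "(h,r') \<in> E")
        case True
        then have "h \<noteq> r'" using diag_notin_E by auto
        then show ?thesis
          using z[of "(h,r')"] True r r' \<open>r \<noteq> h\<close> by (simp add: lookup_add crd_br crd_vec)
      next
        case False
        then have "(r',h) \<in> E" using r' by (auto simp: adj_def)
        moreover from this have "h \<noteq> r'" using diag_notin_E by auto
        ultimately show ?thesis
          using z[of "(r',h)"] r r' \<open>r \<noteq> h\<close> by (simp add: lookup_add crd_br crd_vec)
      qed
    qed
    show ?thesis
      unfolding mem_pairs_space[OF fP]
    proof (intro allI impI)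
      fix f assume f: "crd (D (unit_vec e)) f \<noteq> 0"
      then have "f \<in> vertex_pairs {..<q} \<union> E" using inV mem_V by blast
      then show "f \<in> P" using f hub by (auto simp: P_def vertex_pairs_def)
    qed
  qed
  have "D ` coord_space (prod_encode ` P) \<subseteq> pairs_space P"
    using PV img fP by (intro coord_space_linear_image[OF _ Dl subspace_V] subspace_pairs_space)
      (auto simp: pairs_space_def)
  then show ?thesis by (simp add: pairs_space_def P_def)
qed

text \<open>Let \<open>d\<close> be the vertex diagonal of \<open>D\<close>. Orthogonality of \<open>Ric\<close> to the derivation with eigenvalues \<open>w\<close> is
  a linear equation in \<open>c\<close> and \<open>d\<close>; together with \<open>tr Ric < 0\<close> it forces \<open>c < 0\<close>. Subtracting the equation for the
  indicator of the non-hubs from the trace inequality for the filtration leaves only the edges between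
  hubs.\<close>

theorem einstein_nilradical_soliton_weights:
  assumes ein: "einstein_nilradical V br"
    and H: "H \<subseteq> {..<q}"
    and far: "\<And>r h. r \<in> {..<q} - H \<Longrightarrow> h \<in> H \<Longrightarrow> \<exists>r'<q. r' \<noteq> r \<and> adj h r' \<and> \<not> adj r r'"
    and HE: "(a, b) \<in> E" "a \<in> H" "b \<in> H"
  shows "\<exists>\<xi>. soliton_weights \<xi> \<and> (\<Sum>(u,v)\<in>{(u,v)\<in>E. u \<in> H \<and> v \<in> H}. \<xi> u + \<xi> v) > 0"
proof -
  obtain ip c D where ip: "inner_product_on V ip" and D: "derivation_on V br D"
    and Ric: "\<And>X. X \<in> V \<Longrightarrow> ricci_operator V br ip X = c *\<^sub>R X + D X"
    using ein by (auto simp: einstein_nilradical_def)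
  interpret M: metric_two_step V ip br
    using lie_algebra_V ip by unfold_locales (auto simp: lie_algebra_def br_br)
  have DV: "x \<in> V \<Longrightarrow> D x \<in> V" and Dl: "linear_on V D" for x
    using D by (auto simp: derivation_on_def)
  define P where "P = vertex_pairs {..<q} \<union> E"
  have fP: "finite P" unfolding P_def by (rule finite_P) simp
  have VP: "V = pairs_space P" by (simp add: graph_space_def P_def)
  define d where "d v = crd (D (unit_vec (v,v))) (v,v)" for v
  have dE: "crd (D (unit_vec e)) e = d (fst e) + d (snd e)" if "e \<in> E" for e
    using derivation_edge_diagonal[OF D, of "fst e" "snd e"] that by (simp add: d_def)
  have sumP: "(\<Sum>e\<in>vertex_pairs S \<union> E'. f e) = (\<Sum>v\<in>S. f (v,v)) + (\<Sum>e\<in>E'. f e)"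
    if "finite S" "E' \<subseteq> E" for S E' and f :: "nat \<times> nat \<Rightarrow> real"
  proof -
    have "finite E'" using that finite_E finite_subset by blast
    moreover have "vertex_pairs S \<inter> E' = {}" using vertex_pairs_disjoint that by blast
    moreover have "(\<Sum>e\<in>vertex_pairs S. f e) = (\<Sum>v\<in>S. f (v,v))"
      unfolding vertex_pairs_def by (subst sum.reindex) (auto simp: inj_on_def)
    ultimately show ?thesis using that by (subst sum.union_disjoint) (auto simp: vertex_pairs_def)
  qed
  have traceRic: "trace_on (pairs_space Q) M.Ric = (\<Sum>e\<in>Q. c + crd (D (unit_vec e)) e)"
    if Q: "Q \<subseteq> P" "D ` pairs_space Q \<subseteq> pairs_space Q" for Q
  proof -
    have fQ: "finite Q" using Q fP finite_subset by blast
    have QV: "pairs_space Q \<subseteq> V"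
      unfolding VP using Q vec_in_pairs_space by (intro pairs_space_minimal subspace_pairs_space) blast
    have R: "M.Ric x \<in> pairs_space Q" if "x \<in> pairs_space Q" for x
    proof -
      have "M.Ric x = c *\<^sub>R x + D x" using that QV by (intro Ric) auto
      also have "\<dots> \<in> pairs_space Q"
        using that Q by (intro subspace_add subspace_scale subspace_pairs_space) auto
      finally show ?thesis .
    qed
    have "linear_on (pairs_space Q) M.Ric"
      using M.Ric_linear QV unfolding linear_on_def by blast
    then have "trace_on (pairs_space Q) M.Ric = (\<Sum>e\<in>Q. crd (M.Ric (unit_vec e)) e)"
      using R fQ by (intro trace_pairs_space) auto
    also have "\<dots> = (\<Sum>e\<in>Q. c + crd (D (unit_vec e)) e)"
    proof (intro sum.cong refl)
      fix e assume "e \<in> Q"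
      then have "unit_vec e \<in> V" using QV vec_in_pairs_space by blast
      then show "crd (M.Ric (unit_vec e)) e = c + crd (D (unit_vec e)) e"
        by (simp add: Ric lookup_add coord_scaleR crd_vec)
    qed
    finally show ?thesis .
  qed
  \<comment> \<open>The trace of \<open>Ric \<circ> \<delta>\<close> vanishes for the diagonal derivation \<open>\<delta>\<close> with eigenvalues \<open>w\<close>; it is
    evaluated in the graph basis.\<close>
  have T: "(\<Sum>v<q. w v * (c + d v)) + (\<Sum>(u,v)\<in>E. (w u + w v) * (c + d u + d v)) = 0" for w
  proof -
    define \<delta> where "\<delta> = diag_derivation w"
    have \<delta>: "derivation_on V br \<delta>" unfolding \<delta>_def by (rule diag_derivation)
    then have \<delta>V: "x \<in> V \<Longrightarrow> \<delta> x \<in> V" and \<delta>l: "linear_on V \<delta>" for x by (auto simp: derivation_on_def)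
    have "0 = trace_on V (\<lambda>x. M.Ric (\<delta> x))" using M.trace_Ric_derivation[OF \<delta>] by simp
    also have "\<dots> = (\<Sum>e\<in>P. crd (M.Ric (\<delta> (unit_vec e))) e)"
    proof -
      have "linear_on V (\<lambda>x. M.Ric (\<delta> x))"
        using M.Ric_linear \<delta>l \<delta>V unfolding linear_on_def by auto
      moreover have "(\<lambda>x. M.Ric (\<delta> x)) ` V \<subseteq> V"
        using M.Ric_ip \<delta>V by auto
      ultimately show ?thesis using trace_pairs_space[OF fP, folded VP] by blast
    qed
    also have "\<dots> = (\<Sum>v<q. crd (M.Ric (\<delta> (unit_vec (v,v)))) (v,v)) + (\<Sum>e\<in>E. crd (M.Ric (\<delta> (unit_vec e))) e)"
      unfolding P_def by (rule sumP) auto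
    also have "(\<Sum>v<q. crd (M.Ric (\<delta> (unit_vec (v,v)))) (v,v)) = (\<Sum>v<q. w v * (c + d v))"
    proof (intro sum.cong refl)
      fix v assume "v \<in> {..<q}"
      then have v: "v < q" by simp
      then have "M.Ric (\<delta> (unit_vec (v,v))) = w v *\<^sub>R M.Ric (unit_vec (v,v))"
        using M.Ric_linear vec_vertex_in_V[OF v] by (simp add: \<delta>_def diag_derivation_vec linear_on_def)
      then show "crd (M.Ric (\<delta> (unit_vec (v,v)))) (v,v) = w v * (c + d v)"
        using Ric[OF vec_vertex_in_V[OF v]] by (simp add: coord_scaleR lookup_add crd_vec d_def)
    qed
    also have "(\<Sum>e\<in>E. crd (M.Ric (\<delta> (unit_vec e))) e) = (\<Sum>(u,v)\<in>E. (w u + w v) * (c + d u + d v))"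
    proof (intro sum.cong refl, clarify)
      fix u v assume e: "(u,v) \<in> E"
      then have "M.Ric (\<delta> (unit_vec (u,v))) = (w u + w v) *\<^sub>R M.Ric (unit_vec (u,v))"
        using M.Ric_linear vec_edge_in_V[OF e] by (simp add: \<delta>_def diag_derivation_vec linear_on_def)
      then show "crd (M.Ric (\<delta> (unit_vec (u,v)))) (u,v) = (w u + w v) * (c + d u + d v)"
        using Ric[OF vec_edge_in_V[OF e]] dE[OF e] by (simp add: coord_scaleR lookup_add crd_vec add.assoc)
    qed
    finally show ?thesis by simp
  qed
  have sumPd: "(\<Sum>e\<in>P. c + crd (D (unit_vec e)) e) = (\<Sum>v<q. c + d v) + (\<Sum>(u,v)\<in>E. c + d u + d v)"
  proof -
    have "(\<Sum>e\<in>P. c + crd (D (unit_vec e)) e) = (\<Sum>v<q. c + d v) + (\<Sum>e\<in>E. c + crd (D (unit_vec e)) e)"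
      unfolding P_def d_def by (rule sumP) auto
    then show ?thesis by (simp add: dE case_prod_beta add.assoc)
  qed
  have neg: "(\<Sum>v<q. c + d v) + (\<Sum>(u,v)\<in>E. c + d u + d v) < 0"
  proof -
    have "bracket_span br V V \<noteq> {0}"
      using two_step_nilpotent_V HE by (auto simp: two_step_nilpotent_def)
    then have "trace_on V M.Ric < 0" by (rule M.trace_Ric_neg)
    moreover have "trace_on V M.Ric = (\<Sum>e\<in>P. c + crd (D (unit_vec e)) e)"
      using traceRic[of P, folded VP] DV by auto
    ultimately show ?thesis using sumPd by simp
  qed
  have c: "c < 0"
  proof (rule ccontr)
    \<comment> \<open>For \<open>w = d\<close>, the equation writes the sum of squares of the diagonal entries of \<open>Ric\<close> as \<open>c tr Ric\<close>.\<close>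
    assume "\<not> c < 0"
    have "(\<Sum>v<q. (c + d v)\<^sup>2) + (\<Sum>(u,v)\<in>E. (c + d u + d v)\<^sup>2)
      = c * ((\<Sum>v<q. c + d v) + (\<Sum>(u,v)\<in>E. c + d u + d v))
       + ((\<Sum>v<q. d v * (c + d v)) + (\<Sum>(u,v)\<in>E. (d u + d v) * (c + d u + d v)))"
      by (simp add: sum_distrib_left sum.distrib[symmetric] distrib_left case_prod_beta power2_eq_square algebra_simps)
    also have "\<dots> \<le> 0" using T[of d] neg \<open>\<not> c < 0\<close> by (simp add: mult_nonneg_nonpos)
    finally have le: "(\<Sum>v<q. (c + d v)\<^sup>2) + (\<Sum>(u,v)\<in>E. (c + d u + d v)\<^sup>2) \<le> 0" .
    have n1: "0 \<le> (\<Sum>v<q. (c + d v)\<^sup>2)" by (intro sum_nonneg) auto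
    have n2: "0 \<le> (\<Sum>(u,v)\<in>E. (c + d u + d v)\<^sup>2)" by (intro sum_nonneg) auto
    have "(\<Sum>v<q. (c + d v)\<^sup>2) = 0" "(\<Sum>(u,v)\<in>E. (c + d u + d v)\<^sup>2) = 0" using le n1 n2 by auto
    then have "\<forall>v<q. c + d v = 0" "\<forall>(u,v)\<in>E. c + d u + d v = 0"
      using finite_E by (auto simp: sum_nonneg_eq_0_iff case_prod_beta)
    then have "(\<Sum>v<q. c + d v) + (\<Sum>(u,v)\<in>E. c + d u + d v) = 0"
      by (simp add: case_prod_beta sum.neutral)
    then show False using neg by simp
  qed
  define S where "S = {..<q} - H"
  have filt: "(\<Sum>(u,v)\<in>{(u,v)\<in>E. u \<in> H \<and> v \<in> H}. c + d u + d v) > 0"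
  proof -
    define W where "W = pairs_space (vertex_pairs S \<union> E)"
    define EU where "EU = {(u,v)\<in>E. u \<in> S \<and> v \<in> S}"
    have SP: "vertex_pairs S \<union> E \<subseteq> P" by (auto simp: S_def P_def vertex_pairs_def)
    have WV: "W \<subseteq> V"
      unfolding W_def VP using SP vec_in_pairs_space
      by (intro pairs_space_minimal subspace_pairs_space) blast
    have W: "subspace W" "W \<subseteq> V"
      unfolding W_def by (rule subspace_pairs_space) (rule WV[unfolded W_def])
    have dW: "bracket_span br V V \<subseteq> W"
      unfolding derived_V W_def by (intro pairs_space_minimal subspace_pairs_space vec_in_pairs_space) auto
    have U: "pairs_space EU = bracket_span br W W"
      unfolding W_def EU_def using bracket_span_vertex_pairs[of S] by (simp add: S_def)
    have DW: "D ` W \<subseteq> W" unfolding W_def S_def by (rule derivation_preserves_nonhubs[OF D H far])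
    have DU: "D ` pairs_space EU \<subseteq> pairs_space EU"
    proof -
      have EUV: "pairs_space EU \<subseteq> V"
        unfolding VP using vec_in_pairs_space
        by (intro pairs_space_minimal subspace_pairs_space) (auto simp: EU_def P_def)
      have "D (unit_vec e) \<in> pairs_space EU" if eEU: "e \<in> EU" for e
      proof -
        obtain u v where e: "e = (u,v)" "(u,v) \<in> E" "u \<in> S" "v \<in> S" using eEU by (auto simp: EU_def)
        have w: "unit_vec (u,u) \<in> W" "unit_vec (v,v) \<in> W"
          unfolding W_def using e by (auto intro!: vec_in_pairs_space simp: vertex_pairs_def)
        have "D (br (unit_vec (u,u)) (unit_vec (v,v))) = br (D (unit_vec (u,u))) (unit_vec (v,v)) + br (unit_vec (u,u)) (D (unit_vec (v,v)))"
          using D w W by (auto simp: derivation_on_def)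
        moreover have "br (D (unit_vec (u,u))) (unit_vec (v,v)) \<in> pairs_space EU"
          "br (unit_vec (u,u)) (D (unit_vec (v,v))) \<in> pairs_space EU"
          unfolding U using w DW by (auto intro!: M.br_in_derived)
        ultimately show ?thesis
          using br_vertices e subspace_add[OF subspace_pairs_space] by metis
      qed
      then have "D ` coord_space (prod_encode ` EU) \<subseteq> pairs_space EU"
        using EUV finite_subset[OF _ finite_E, of EU]
        by (intro coord_space_linear_image[OF _ Dl subspace_V] subspace_pairs_space)
          (auto simp: pairs_space_def EU_def)
      then show ?thesis by (simp add: pairs_space_def)
    qed
    have Rinv: "M.Ric ` Y \<subseteq> Y" if "D ` Y \<subseteq> Y" "subspace Y" "Y \<subseteq> V" for Y
    proof clarify
      fix x assume x: "x \<in> Y"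
      then have "M.Ric x = c *\<^sub>R x + D x" using that by (intro Ric) auto
      also have "\<dots> \<in> Y" using that x by (intro subspace_add subspace_scale) auto
      finally show "M.Ric x \<in> Y" .
    qed
    have UW: "pairs_space EU \<subseteq> V" using U M.derived_subset W by simp
    have strict: "\<not> bracket_span br V V \<subseteq> bracket_span br V W"
    proof
      assume a: "bracket_span br V V \<subseteq> bracket_span br V W"
      have fS: "finite (vertex_pairs S \<union> E)" by (rule finite_P) (simp add: S_def)
      have "bracket_span br V W \<subseteq> {x. crd x (a,b) = 0}"
        unfolding bracket_span_def
      proof (rule span_minimal, clarify)
        fix x y assume "y \<in> W"
        then have "crd y (a,a) = 0" "crd y (b,b) = 0"
          unfolding W_def mem_pairs_space[OF fS] using HE diag_notin_E by (auto simp: vertex_pairs_def S_def)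
        then show "crd (br x y) (a,b) = 0" by (simp add: crd_br)
      qed (auto simp: subspace_def lookup_add coord_scaleR)
      moreover have "unit_vec (a,b) \<in> bracket_span br V V" unfolding derived_V using HE by (intro vec_in_pairs_space)
      ultimately have "crd (unit_vec (a,b)) (a,b) = 0" using a by auto
      then show False by (simp add: crd_vec)
    qed
    have "0 < trace_on W M.Ric + trace_on (pairs_space EU) M.Ric"
      by (rule M.trace_Ric_filtration_pos[OF W dW U Rinv[OF DW W] Rinv[OF DU subspace_pairs_space UW] strict])
    also have "trace_on W M.Ric = (\<Sum>v\<in>S. c + d v) + (\<Sum>(u,v)\<in>E. c + d u + d v)"
    proof -
      have "trace_on W M.Ric = (\<Sum>e\<in>vertex_pairs S \<union> E. c + crd (D (unit_vec e)) e)"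
        unfolding W_def using SP DW by (intro traceRic) (auto simp: W_def)
      also have "\<dots> = (\<Sum>v\<in>S. c + d v) + (\<Sum>e\<in>E. c + crd (D (unit_vec e)) e)"
        unfolding d_def by (rule sumP) (auto simp: S_def)
      finally show ?thesis by (simp add: dE case_prod_beta add.assoc)
    qed
    also have "trace_on (pairs_space EU) M.Ric = (\<Sum>(u,v)\<in>E. if u \<in> S \<and> v \<in> S then c + d u + d v else 0)"
    proof -
      have "trace_on (pairs_space EU) M.Ric = (\<Sum>e\<in>EU. c + crd (D (unit_vec e)) e)"
        using DU by (intro traceRic) (auto simp: EU_def P_def)
      also have "\<dots> = (\<Sum>(u,v)\<in>EU. c + d u + d v)"
        by (intro sum.cong refl) (auto simp: dE EU_def)
      also have "\<dots> = (\<Sum>(u,v)\<in>E. if u \<in> S \<and> v \<in> S then c + d u + d v else 0)"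
        by (rule sum.mono_neutral_cong_left) (auto simp: EU_def finite_E split: if_splits)
      finally show ?thesis .
    qed
    also have "(\<Sum>v\<in>S. c + d v) = (\<Sum>v<q. of_bool (v \<in> S) * (c + d v))"
      by (rule sum.mono_neutral_cong_left) (auto simp: S_def)
    also have "\<dots> = - (\<Sum>(u,v)\<in>E. (of_bool (u \<in> S) + of_bool (v \<in> S)) * (c + d u + d v))"
      using T[of "\<lambda>v. of_bool (v \<in> S)"] by simp
    finally have "0 < (\<Sum>(u,v)\<in>E. c + d u + d v)
        + (\<Sum>(u,v)\<in>E. if u \<in> S \<and> v \<in> S then c + d u + d v else 0)
        - (\<Sum>(u,v)\<in>E. (of_bool (u \<in> S) + of_bool (v \<in> S)) * (c + d u + d v))" by simp
    also have "\<dots> = (\<Sum>(u,v)\<in>E. (c + d u + d v) + (if u \<in> S \<and> v \<in> S then c + d u + d v else 0)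
        - (of_bool (u \<in> S) + of_bool (v \<in> S)) * (c + d u + d v))"
      by (simp add: sum.distrib sum_subtractf case_prod_beta)
    also have "\<dots> = (\<Sum>(u,v)\<in>{(u,v)\<in>E. u \<in> H \<and> v \<in> H}. c + d u + d v)"
      using E_lt E_q by (intro sum.mono_neutral_cong_right finite_E)
        (auto simp: S_def of_bool_def split: if_splits)
    finally show ?thesis .
  qed
  define \<xi> where "\<xi> v = - 2 * d v / c - 1" for v
  have \<xi>1: "c + d v = c / 2 * (1 - \<xi> v)" for v using c by (simp add: \<xi>_def field_simps)
  have \<xi>2: "c + d u + d v = - c / 2 * (\<xi> u + \<xi> v)" for u v using c by (simp add: \<xi>_def field_simps)
  have "soliton_weights \<xi>"
    unfolding soliton_weights_def
  proof
    fix w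
    define X where "X = (\<Sum>v<q. w v * \<xi> v)"
    define Y where "Y = (\<Sum>(u,v)\<in>E. (w u + w v) * (\<xi> u + \<xi> v))"
    have "(\<Sum>v<q. w v * (c + d v)) = (\<Sum>v<q. c / 2 * (w v - w v * \<xi> v))"
      unfolding \<xi>1 by (intro sum.cong refl) (simp add: field_simps)
    also have "\<dots> = c / 2 * ((\<Sum>v<q. w v) - X)"
      unfolding X_def by (simp only: sum_subtractf sum_distrib_left[symmetric])
    finally have 1: "(\<Sum>v<q. w v * (c + d v)) = c / 2 * ((\<Sum>v<q. w v) - X)" .
    have "(\<Sum>(u,v)\<in>E. (w u + w v) * (c + d u + d v))
        = (\<Sum>(u,v)\<in>E. - c / 2 * ((w u + w v) * (\<xi> u + \<xi> v)))"
      unfolding \<xi>2 by (intro sum.cong refl) auto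
    also have "\<dots> = - c / 2 * Y"
      unfolding Y_def sum_distrib_left by (simp only: case_prod_unfold)
    finally have "c / 2 * ((\<Sum>v<q. w v) - X) - c / 2 * Y = 0"
      using T[of w] 1 by simp
    then have "c / 2 * ((\<Sum>v<q. w v) - X - Y) = 0" by (simp only: right_diff_distrib)
    then have "X + Y = (\<Sum>v<q. w v)" using c by simp
    then show "(\<Sum>v<q. w v * \<xi> v) + (\<Sum>(u,v)\<in>E. (w u + w v) * (\<xi> u + \<xi> v)) = (\<Sum>v<q. w v)"
      by (simp add: X_def Y_def)
  qed
  moreover have "(\<Sum>(u,v)\<in>{(u,v)\<in>E. u \<in> H \<and> v \<in> H}. \<xi> u + \<xi> v) > 0"
  proof -
    have "0 < - c / 2 * (\<Sum>(u,v)\<in>{(u,v)\<in>E. u \<in> H \<and> v \<in> H}. \<xi> u + \<xi> v)"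
      using filt unfolding \<xi>2 by (simp add: sum_distrib_left case_prod_beta)
    then show ?thesis by (rule zero_less_mult_pos) (use c in simp)
  qed
  ultimately show ?thesis by blast
qed

text \<open>The left-hand side of the system is a positive definite form \<open>B(w, \<xi>)\<close>. The claim is
  \<open>B(\<xi> - \<eta>, \<xi> - \<eta>) \<ge> 0\<close> expanded, as \<open>B(w, \<xi>) = \<Sum> w\<close> for \<open>w = \<xi>\<close> and \<open>w = \<eta>\<close>.\<close>

lemma soliton_weights_sum_ge:
  assumes "soliton_weights \<xi>"
  shows "(\<Sum>v<q. \<xi> v) \<ge> 2 * (\<Sum>v<q. \<eta> v) - (\<Sum>v<q. (\<eta> v)\<^sup>2) - (\<Sum>(u,v)\<in>E. (\<eta> u + \<eta> v)\<^sup>2)"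
proof -
  have eq: "(\<Sum>v<q. w v * \<xi> v) + (\<Sum>(u,v)\<in>E. (w u + w v) * (\<xi> u + \<xi> v)) = (\<Sum>v<q. w v)" for w
    using assms by (simp add: soliton_weights_def)
  have "0 \<le> (\<Sum>v<q. (\<xi> v - \<eta> v)\<^sup>2) + (\<Sum>(u,v)\<in>E. ((\<xi> u + \<xi> v) - (\<eta> u + \<eta> v))\<^sup>2)"
    by (intro add_nonneg_nonneg sum_nonneg) auto
  also have "(\<Sum>v<q. (\<xi> v - \<eta> v)\<^sup>2)
      = (\<Sum>v<q. \<xi> v * \<xi> v) - 2 * (\<Sum>v<q. \<eta> v * \<xi> v) + (\<Sum>v<q. (\<eta> v)\<^sup>2)"
    unfolding sum_distrib_left sum_subtractf[symmetric] sum.distrib[symmetric]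
    by (intro sum.cong refl) (simp add: power2_eq_square algebra_simps)
  also have "(\<Sum>(u,v)\<in>E. ((\<xi> u + \<xi> v) - (\<eta> u + \<eta> v))\<^sup>2)
      = (\<Sum>(u,v)\<in>E. (\<xi> u + \<xi> v) * (\<xi> u + \<xi> v)) - 2 * (\<Sum>(u,v)\<in>E. (\<eta> u + \<eta> v) * (\<xi> u + \<xi> v))
        + (\<Sum>(u,v)\<in>E. (\<eta> u + \<eta> v)\<^sup>2)"
    unfolding sum_distrib_left sum_subtractf[symmetric] sum.distrib[symmetric]
    by (intro sum.cong refl) (simp add: case_prod_unfold power2_eq_square algebra_simps)
  finally show ?thesis using eq[of \<xi>] eq[of \<eta>] by (simp add: algebra_simps)
qed

end

section \<open>Graphs with two adjacent hubs\<close>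

text \<open>The hubs are the adjacent vertices \<open>0\<close> and \<open>1\<close>, with further neighbours \<open>A\<close> and \<open>B\<close>; \<open>R\<close> contains the edges between non-hubs.\<close>

definition two_hub_edges :: "nat set \<Rightarrow> nat set \<Rightarrow> (nat \<times> nat) set \<Rightarrow> (nat \<times> nat) set" where
  "two_hub_edges A B R = {(0, 1)} \<union> Pair 0 ` A \<union> Pair 1 ` B \<union> R"

text \<open>As every non-hub is joined to a hub, the graph is connected. The conditions \<open>far_A\<close> and \<open>far_B\<close> say
  that no derivation moves a non-hub towards a hub.\<close>

locale two_hub_graph =
  fixes q :: nat and A B :: "nat set" and R :: "(nat \<times> nat) set"
  assumes q2: "q \<ge> 2" and AB: "A \<union> B = {2..<q}"
    and R: "R \<subseteq> {(u, v). 2 \<le> u \<and> u < v \<and> v < q}"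
    and far_A: "r \<in> {2..<q} \<Longrightarrow> \<exists>r'\<in>A. r' \<noteq> r \<and> (r, r') \<notin> R \<and> (r', r) \<notin> R"
    and far_B: "r \<in> {2..<q} \<Longrightarrow> \<exists>r'\<in>B. r' \<noteq> r \<and> (r, r') \<notin> R \<and> (r', r) \<notin> R"
begin

abbreviation "E \<equiv> two_hub_edges A B R"

sublocale ordered_graph q E
proof
  have "A \<subseteq> {2..<q}" "B \<subseteq> {2..<q}" using AB by auto
  then show "u < v" "v < q" if "(u, v) \<in> E" for u v
    using that R q2 by (auto simp: two_hub_edges_def)
qed

lemma finite_parts: "finite A" "finite B" "finite R"
proof -
  have "finite (A \<union> B)" using AB by simp
  then show "finite A" "finite B" by auto
  show "finite R" using finite_E by (rule rev_finite_subset) (auto simp: two_hub_edges_def)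
qed

lemma sum_E: "(\<Sum>e\<in>E. f e) = f (0, 1) + (\<Sum>v\<in>A. f (0, v)) + (\<Sum>v\<in>B. f (1, v)) + (\<Sum>e\<in>R. f e)"
  for f :: "nat \<times> nat \<Rightarrow> 'b::comm_monoid_add"
proof -
  have s: "A \<subseteq> {2..<q}" "B \<subseteq> {2..<q}" using AB by auto
  have "(\<Sum>e\<in>E. f e) = (\<Sum>e\<in>{(0, 1)} \<union> Pair 0 ` A \<union> Pair 1 ` B. f e) + (\<Sum>e\<in>R. f e)"
    unfolding two_hub_edges_def using finite_parts R by (intro sum.union_disjoint) auto
  also have "(\<Sum>e\<in>{(0, 1)} \<union> Pair 0 ` A \<union> Pair 1 ` B. f e)
      = (\<Sum>e\<in>{(0, 1)} \<union> Pair 0 ` A. f e) + (\<Sum>e\<in>Pair 1 ` B. f e)"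
    using finite_parts by (intro sum.union_disjoint) auto
  also have "(\<Sum>e\<in>{(0, 1)} \<union> Pair 0 ` A. f e) = f (0, 1) + (\<Sum>e\<in>Pair 0 ` A. f e)"
    using finite_parts s by (subst sum.union_disjoint) auto
  also have "(\<Sum>e\<in>Pair 0 ` A. f e) = (\<Sum>v\<in>A. f (0, v))"
    by (subst sum.reindex) (auto simp: inj_on_def)
  also have "(\<Sum>e\<in>Pair 1 ` B. f e) = (\<Sum>v\<in>B. f (1, v))"
    by (subst sum.reindex) (auto simp: inj_on_def)
  finally show ?thesis .
qed

lemma card_E: "card E = 1 + card A + card B + card R"
  using sum_E[of "\<lambda>_. 1::nat"] by simp

lemma sum_vertices: "(\<Sum>v<q. f v) = f 0 + f 1 + (\<Sum>v\<in>{2..<q}. f v)"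
  for f :: "nat \<Rightarrow> 'b::comm_monoid_add"
proof -
  have "{..<q} = {0, 1} \<union> {2..<q}" using q2 by auto
  then have "(\<Sum>v<q. f v) = (\<Sum>v\<in>{0, 1}. f v) + (\<Sum>v\<in>{2..<q}. f v)"
    by (simp only:) (rule sum.union_disjoint, auto)
  then show ?thesis by simp
qed

lemma indecomposable_E: "indecomposable V br"
proof (rule indecomposable_V[OF _ q2])
  fix S assume S: "S \<subseteq> {..<q}" "S \<noteq> {}" "S \<noteq> {..<q}"
  have hub: "(0, 1) \<in> E" by (simp add: two_hub_edges_def)
  have leaf: "(0, v) \<in> E \<or> (1, v) \<in> E" if "v < q" "v \<noteq> 0" "v \<noteq> 1" for v
  proof -
    have "v \<in> A \<union> B" unfolding AB using that by auto
    then show ?thesis by (auto simp: two_hub_edges_def)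
  qed
  show "\<exists>(u,v)\<in>E. (u \<in> S) \<noteq> (v \<in> S)"
  proof (rule ccontr)
    assume "\<not> ?thesis"
    then have eq: "(u \<in> S) = (v \<in> S)" if "(u, v) \<in> E" for u v using that by auto
    have "(v \<in> S) = (0 \<in> S)" if "v < q" for v
      using eq[OF hub] leaf[OF that] eq by metis
    then show False using S by auto
  qed
qed

lemma not_einstein_if_weights_nonpos:
  assumes "\<And>\<xi>. soliton_weights \<xi> \<Longrightarrow> \<xi> 0 + \<xi> 1 \<le> 0"
  shows "\<not> einstein_nilradical V br"
proof
  assume ein: "einstein_nilradical V br"
  have adj_iff: "adj u v \<longleftrightarrow> (u, v) \<in> E \<or> (v, u) \<in> E" for u v by (rule adj_def)
  have adjA: "adj 0 v" if "v \<in> A" for v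
    unfolding adj_iff unfolding two_hub_edges_def using that by simp
  have adjB: "adj 1 v" if "v \<in> B" for v
    unfolding adj_iff unfolding two_hub_edges_def using that by simp
  have adjR: "(u, v) \<in> R \<or> (v, u) \<in> R" if "adj u v" "u \<ge> 2" "v \<ge> 2" for u v
    using that unfolding adj_iff unfolding two_hub_edges_def by auto
  have "\<exists>\<xi>. soliton_weights \<xi> \<and> (\<Sum>(u,v)\<in>{(u,v)\<in>E. u \<in> {0,1} \<and> v \<in> {0,1}}. \<xi> u + \<xi> v) > 0"
  proof (rule einstein_nilradical_soliton_weights[OF ein])
    show "{0, 1} \<subseteq> {..<q}" using q2 by auto
    show "(0, 1) \<in> E" by (simp add: two_hub_edges_def)
    fix r h :: nat assume rh: "r \<in> {..<q} - {0, 1}" "h \<in> {0, 1}"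
    then have r: "r \<in> {2..<q}" by auto
    show "\<exists>r'<q. r' \<noteq> r \<and> adj h r' \<and> \<not> adj r r'"
    proof (cases "h = 0")
      case True
      obtain r' where r': "r' \<in> A" "r' \<noteq> r" "(r, r') \<notin> R" "(r', r) \<notin> R" using far_A[OF r] by blast
      then have "r' \<in> {2..<q}" using AB by blast
      then show ?thesis using adjA adjR[of r r'] r r' True by (intro exI[of _ r']) auto
    next
      case False
      obtain r' where r': "r' \<in> B" "r' \<noteq> r" "(r, r') \<notin> R" "(r', r) \<notin> R" using far_B[OF r] by blast
      then have "r' \<in> {2..<q}" using AB by blast
      then show ?thesis using adjB adjR[of r r'] r r' rh False by (intro exI[of _ r']) auto
    qed
  qed auto
  then obtain \<xi> where \<xi>: "soliton_weights \<xi>"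
    "(\<Sum>(u,v)\<in>{(u,v)\<in>E. u \<in> {0,1} \<and> v \<in> {0,1}}. \<xi> u + \<xi> v) > 0" by blast
  have "{(u,v)\<in>E. u \<in> {0,1} \<and> v \<in> {0,1}} = {(0,1)}"
    using E_less by (auto simp: two_hub_edges_def)
  then show False using assms[OF \<xi>(1)] \<xi>(2) by simp
qed

lemma two_hub_algebra:
  assumes "\<And>\<xi>. soliton_weights \<xi> \<Longrightarrow> \<xi> 0 + \<xi> 1 \<le> 0"
  shows "\<exists>(V :: (nat \<Rightarrow>\<^sub>0 real) set) br. lie_algebra V br \<and> indecomposable V br \<and>
    two_step_nilpotent V br \<and> has_type V br (1 + card A + card B + card R) q \<and> \<not> einstein_nilradical V br"
proof -
  have "E \<noteq> {}" by (simp add: two_hub_edges_def)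
  then show ?thesis
    using lie_algebra_V indecomposable_E two_step_nilpotent_V has_type_V not_einstein_if_weights_nonpos[OF assms]
    unfolding card_E by blast
qed

lemma soliton_weights_eq:
  assumes "soliton_weights \<xi>"
  shows "w 0 * \<xi> 0 + w 1 * \<xi> 1 + (\<Sum>v\<in>{2..<q}. w v * \<xi> v) + (w 0 + w 1) * (\<xi> 0 + \<xi> 1)
    + (\<Sum>v\<in>A. (w 0 + w v) * (\<xi> 0 + \<xi> v)) + (\<Sum>v\<in>B. (w 1 + w v) * (\<xi> 1 + \<xi> v))
    + (\<Sum>(u,v)\<in>R. (w u + w v) * (\<xi> u + \<xi> v)) = w 0 + w 1 + (\<Sum>v\<in>{2..<q}. w v)"
proof -
  have "(\<Sum>v<q. w v * \<xi> v) + (\<Sum>(u,v)\<in>E. (w u + w v) * (\<xi> u + \<xi> v)) = (\<Sum>v<q. w v)"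
    using assms by (simp add: soliton_weights_def)
  then show ?thesis unfolding sum_vertices sum_E by (simp add: add.assoc)
qed

end

section \<open>Sparse graphs: independent non-hubs\<close>

text \<open>Here \<open>x\<close> and \<open>y\<close> are the values of \<open>\<xi>\<close> at the two hubs. A neighbour of only one hub has degree one and a
  common neighbour has degree two; taking \<open>w\<close> to be \<open>1\<close> at the hub, \<open>- 1/2\<close> at its private neighbours and
  \<open>- 1/3\<close> at the common ones eliminates \<open>\<xi>\<close> at all neighbours.\<close>

lemma hub_equation:
  fixes x y :: real and \<xi> :: "nat \<Rightarrow> real"
  assumes fin: "finite A" "finite B"
    and eq: "\<And>a b w. a * x + b * y + (\<Sum>v\<in>A \<union> B. w v * \<xi> v) + (a + b) * (x + y)
      + (\<Sum>v\<in>A. (a + w v) * (x + \<xi> v)) + (\<Sum>v\<in>B. (b + w v) * (y + \<xi> v)) = a + b + (\<Sum>v\<in>A \<union> B. w v)"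
  shows "x * (1 + card (A - B) / 2 + card (A \<inter> B)) + (x + y) * (1 - card (A \<inter> B) / 3)
    = 1 - card (A - B) / 2 - card (A \<inter> B) / 3"
proof -
  define w :: "nat \<Rightarrow> real" where "w v = (if v \<in> A \<inter> B then - 1/3 else if v \<in> A then - 1/2 else 0)" for v
  have sA: "(\<Sum>v\<in>A. f v) = (\<Sum>v\<in>A - B. f v) + (\<Sum>v\<in>A \<inter> B. f v)" for f :: "nat \<Rightarrow> real"
    using sum.Int_Diff[OF fin(1), of f B] by (simp add: add.commute)
  have sB: "(\<Sum>v\<in>B. f v) = (\<Sum>v\<in>B - A. f v) + (\<Sum>v\<in>A \<inter> B. f v)" for f :: "nat \<Rightarrow> real"
    using sum.Int_Diff[OF fin(2), of f A] by (simp add: add.commute Int_commute)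
  have sAB: "(\<Sum>v\<in>A \<union> B. f v) = (\<Sum>v\<in>A - B. f v) + (\<Sum>v\<in>B - A. f v) + (\<Sum>v\<in>A \<inter> B. f v)" for f :: "nat \<Rightarrow> real"
  proof -
    have "A \<union> B = A \<union> (B - A)" by auto
    then have "(\<Sum>v\<in>A \<union> B. f v) = (\<Sum>v\<in>A. f v) + (\<Sum>v\<in>B - A. f v)"
      using fin sum.union_disjoint[of A "B - A" f] by auto
    then show ?thesis by (simp add: sA)
  qed
  have c1: "(\<Sum>v\<in>A - B. f (w v) v) = (\<Sum>v\<in>A - B. f (- 1/2) v)"
    and c2: "(\<Sum>v\<in>B - A. f (w v) v) = (\<Sum>v\<in>B - A. f 0 v)"
    and c3: "(\<Sum>v\<in>A \<inter> B. f (w v) v) = (\<Sum>v\<in>A \<inter> B. f (- 1/3) v)" for f :: "real \<Rightarrow> nat \<Rightarrow> real"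
    by (auto simp: w_def intro!: sum.cong)
  show ?thesis
    using eq[of 1 0 w]
    unfolding sAB sA sB c1[of "\<lambda>w v. w * \<xi> v"] c2[of "\<lambda>w v. w * \<xi> v"] c3[of "\<lambda>w v. w * \<xi> v"]
      c1[of "\<lambda>w v. w"] c2[of "\<lambda>w v. w"] c3[of "\<lambda>w v. w"]
      c1[of "\<lambda>w v. (1 + w) * (x + \<xi> v)"] c3[of "\<lambda>w v. (1 + w) * (x + \<xi> v)"]
      c2[of "\<lambda>w v. (0 + w) * (y + \<xi> v)"] c3[of "\<lambda>w v. (0 + w) * (y + \<xi> v)"]
    by (simp add: sum_distrib_left[symmetric] sum.distrib sum_negf sum_divide_distrib[symmetric]
      sum_distrib_right[symmetric] field_simps)
qed

lemma hub_less_half: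
  fixes x y s l k :: real
  assumes "x * (1 + l / 2 + k) + s * (1 - k / 3) = 1 - l / 2 - k / 3"
    and "l \<ge> 0" "k \<ge> 0" "3 * l + 2 * k \<ge> 6" "s > 0"
  shows "x < s / 2"
proof (rule ccontr)
  assume "\<not> x < s / 2"
  then have "s / 2 * (1 + l / 2 + k) \<le> x * (1 + l / 2 + k)"
    using assms by (intro mult_right_mono) auto
  also have "\<dots> = 1 - l / 2 - k / 3 - s * (1 - k / 3)" using assms(1) by simp
  also have "\<dots> \<le> - s * (1 - k / 3)" using assms(4) by simp
  finally have "s * (3 / 2 + l / 4 + k / 6) \<le> 0" by (simp add: field_simps)
  moreover have "s * (3 / 2 + l / 4 + k / 6) > 0" using assms by (intro mult_pos_pos) auto
  ultimately show False by simp
qed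

text \<open>The last \<open>k\<close> vertices are joined to both hubs and each other one to a single hub, which gives
  \<open>q - 1 + k\<close> edges. The private neighbours of the second hub are \<open>2\<close> and \<open>3\<close>, except that \<open>3\<close> becomes
  common when \<open>k = q - 3\<close>. So either \<open>k \<ge> 3\<close>, or both hubs have two private neighbours. If \<open>\<xi>\<^sub>0 + \<xi>\<^sub>1\<close> were
  positive, each hub would have less than half of it.\<close>

lemma sparse_family:
  assumes q: "q \<ge> 21" and k: "k \<le> q - 3"
  shows "\<exists>(V :: (nat \<Rightarrow>\<^sub>0 real) set) br. lie_algebra V br \<and> indecomposable V br \<and>
    two_step_nilpotent V br \<and> has_type V br (q - 1 + k) q \<and> \<not> einstein_nilradical V br"
proof -
  define A where "A = {4..<q} \<union> {q - k..<q}"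
  define B where "B = {2, 3} \<union> {q - k..<q}"
  have AB: "A \<union> B = {2..<q}" using q k by (auto simp: A_def B_def)
  have Int: "A \<inter> B = {q - k..<q}" using q k by (auto simp: A_def B_def)
  have fin: "finite A" "finite B" by (auto simp: A_def B_def)
  interpret two_hub_graph q A B "{}"
  proof
    show "\<exists>r'\<in>A. r' \<noteq> r \<and> (r, r') \<notin> {} \<and> (r', r) \<notin> {}" for r
      using q by (intro bexI[of _ "if r = 4 then 5 else 4"]) (auto simp: A_def)
    show "\<exists>r'\<in>B. r' \<noteq> r \<and> (r, r') \<notin> {} \<and> (r', r) \<notin> {}" for r
      by (intro bexI[of _ "if r = 2 then 3 else 2"]) (auto simp: B_def)
  qed (use AB q in auto)
  have cInt: "card (A \<inter> B) = k" unfolding Int using k by simp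
  have cAB: "card A + card B = q - 2 + k"
    using card_Un_Int[OF fin] AB cInt by simp
  have l: "3 * card (A - B) + 2 * k \<ge> 6" "3 * card (B - A) + 2 * k \<ge> 6"
  proof -
    have "2 \<le> card (A - B) \<and> 2 \<le> card (B - A)" if "k < 3"
    proof
      have "card {4::nat, 5} \<le> card (A - B)"
        using that q fin by (intro card_mono) (auto simp: A_def B_def)
      then show "2 \<le> card (A - B)" by simp
      have "card {2::nat, 3} \<le> card (B - A)"
        using that q fin by (intro card_mono) (auto simp: A_def B_def)
      then show "2 \<le> card (B - A)" by simp
    qed
    then show "3 * card (A - B) + 2 * k \<ge> 6" "3 * card (B - A) + 2 * k \<ge> 6"
      by (cases "k < 3"; simp)+
  qed
  have "\<xi> 0 + \<xi> 1 \<le> 0" if \<xi>: "soliton_weights \<xi>" for \<xi>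
  proof (rule ccontr)
    assume s: "\<not> \<xi> 0 + \<xi> 1 \<le> 0"
    have eq: "a * \<xi> 0 + b * \<xi> 1 + (\<Sum>v\<in>A \<union> B. w v * \<xi> v) + (a + b) * (\<xi> 0 + \<xi> 1)
      + (\<Sum>v\<in>A. (a + w v) * (\<xi> 0 + \<xi> v)) + (\<Sum>v\<in>B. (b + w v) * (\<xi> 1 + \<xi> v)) = a + b + (\<Sum>v\<in>A \<union> B. w v)"
      for a b w
    proof -
      define w' where "w' v = (if v = 0 then a else if v = 1 then b else w v)" for v
      have w': "w' v = w v" if "v \<in> A \<union> B" for v using that unfolding AB by (simp add: w'_def)
      have "(\<Sum>v\<in>A \<union> B. w' v * \<xi> v) = (\<Sum>v\<in>A \<union> B. w v * \<xi> v)"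
        "(\<Sum>v\<in>A. (a + w' v) * (\<xi> 0 + \<xi> v)) = (\<Sum>v\<in>A. (a + w v) * (\<xi> 0 + \<xi> v))"
        "(\<Sum>v\<in>B. (b + w' v) * (\<xi> 1 + \<xi> v)) = (\<Sum>v\<in>B. (b + w v) * (\<xi> 1 + \<xi> v))"
        "(\<Sum>v\<in>A \<union> B. w' v) = (\<Sum>v\<in>A \<union> B. w v)"
        using w' by (auto intro!: sum.cong)
      moreover have "w' 0 = a" "w' 1 = b" by (simp_all add: w'_def)
      ultimately show ?thesis using soliton_weights_eq[OF \<xi>, of w'] unfolding AB by simp
    qed
    have eq': "a * \<xi> 1 + b * \<xi> 0 + (\<Sum>v\<in>B \<union> A. w v * \<xi> v) + (a + b) * (\<xi> 1 + \<xi> 0)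
      + (\<Sum>v\<in>B. (a + w v) * (\<xi> 1 + \<xi> v)) + (\<Sum>v\<in>A. (b + w v) * (\<xi> 0 + \<xi> v)) = a + b + (\<Sum>v\<in>B \<union> A. w v)"
      for a b w using eq[of b a w] by (simp add: Un_commute add_ac)
    have "\<xi> 0 < (\<xi> 0 + \<xi> 1) / 2"
      using hub_equation[OF fin eq] l s cInt by (intro hub_less_half[of _ "card (A - B)" k]) auto
    moreover have "\<xi> 1 < (\<xi> 0 + \<xi> 1) / 2"
      using hub_equation[OF fin(2,1) eq'] l s cInt
      by (intro hub_less_half[of _ "card (B - A)" k]) (auto simp: Int_commute add.commute)
    ultimately show False by simp
  qed
  note algebra = two_hub_algebra[OF this]
  have "1 + card A + card B + card ({} :: (nat \<times> nat) set) = q - 1 + k" using cAB q by simp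
  then show ?thesis using algebra by simp
qed

section \<open>Dense graphs: hubs joined to everything\<close>

definition clique_pairs :: "nat \<Rightarrow> (nat \<times> nat) set" where
  "clique_pairs q = {(u, v). 4 \<le> u \<and> u < v \<and> v < q}"

lemma sum_clique_pairs: "(\<Sum>e\<in>clique_pairs q. f e) = (\<Sum>v\<in>{4..<q}. \<Sum>u\<in>{4..<v}. f (u, v))"
  for f :: "nat \<times> nat \<Rightarrow> 'b::comm_monoid_add"
proof -
  have "clique_pairs q = (\<lambda>(v, u). (u, v)) ` (SIGMA v:{4..<q}. {4..<v})"
    by (auto simp: clique_pairs_def image_iff)
  moreover have "inj_on (\<lambda>(v, u). (u, v)) (SIGMA v:{4..<q}. {4..<v})" by (auto simp: inj_on_def)
  ultimately have "(\<Sum>e\<in>clique_pairs q. f e) = (\<Sum>(v, u)\<in>(SIGMA v:{4..<q}. {4..<v}). f (u, v))"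
    by (simp add: sum.reindex case_prod_unfold)
  then show ?thesis by (simp add: sum.Sigma)
qed

lemma finite_clique_pairs: "finite (clique_pairs q)"
  by (rule finite_subset[of _ "{..<q} \<times> {..<q}"]) (auto simp: clique_pairs_def)

lemma card_clique_pairs: "2 * card (clique_pairs (w + 4)) = w * (w - 1)"
proof -
  have c: "card (clique_pairs q) = (\<Sum>v\<in>{4..<q}. v - 4)" for q
    using sum_clique_pairs[of "\<lambda>_. 1::nat" q] by simp
  show ?thesis unfolding c
  proof (induction w)
    case (Suc w)
    have "{4..<Suc w + 4} = insert (w + 4) {4..<w + 4}" by auto
    then have "2 * (\<Sum>v\<in>{4..<Suc w + 4}. v - 4) = 2 * w + w * (w - 1)" using Suc by simp
    then show ?case by (cases w) auto
  qed simp
qed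

text \<open>For \<open>q = w + 6\<close>, these are the values on the non-hubs \<open>v \<ge> 3\<close>, multiplied by \<open>10 w + 21\<close>, of the exact
  solution of \<open>3 \<eta>\<^sub>v + \<Sum>\<^bsub>u \<sim> v\<^esub> (\<eta>\<^sub>u + \<eta>\<^sub>v) = 1\<close> on the graph with edges \<open>dense_pairs q\<close> below,
  which optimises the lower bound. Vertex \<open>3\<close> hangs on the clique by its two neighbours \<open>4\<close> and \<open>5\<close>.\<close>

definition test_weight :: "nat \<Rightarrow> nat \<Rightarrow> real" where
  "test_weight w v = (if v = 3 then 2 * real w + 3 else if v = 4 \<or> v = 5 then 3 else 5)"

lemma sum_test_weight_clique:
  "(\<Sum>(u,v)\<in>clique_pairs (w + 6). (test_weight n u + test_weight n v)\<^sup>2) = 36 + 128 * real w + 50 * real w * (real w - 1)"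
proof -
  let ?t = "test_weight n"
  have inner: "(\<Sum>u\<in>{4..<w + 6}. (?t u + 5)\<^sup>2) = 128 + 100 * real w" for w
  proof (induction w)
    case 0
    have "{4..<6::nat} = {4, 5}" by auto
    then show ?case by (simp add: test_weight_def)
  next
    case (Suc w)
    have "{4..<Suc w + 6} = insert (w + 6) {4..<w + 6}" by auto
    then show ?case using Suc by (simp add: test_weight_def)
  qed
  have "(\<Sum>v\<in>{4..<w + 6}. \<Sum>u\<in>{4..<v}. (?t u + ?t v)\<^sup>2) = 36 + 128 * real w + 50 * real w * (real w - 1)" for w
  proof (induction w)
    case 0
    have "{4..<6::nat} = {4, 5}" "{4..<5::nat} = {4}" by auto
    then show ?case by (simp add: test_weight_def)
  next
    case (Suc w)
    have "?t (w + 6) = 5" by (simp add: test_weight_def)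
    moreover have "{4..<Suc w + 6} = insert (w + 6) {4..<w + 6}" by auto
    ultimately show ?case using Suc inner[of w] by (simp add: algebra_simps)
  qed
  then show ?thesis by (simp add: sum_clique_pairs)
qed

text \<open>The non-hub \<open>2\<close> is isolated here: it makes the filtration invariant and contributes the value \<open>1/3\<close> to
  the test vector.\<close>

definition dense_pairs :: "nat \<Rightarrow> (nat \<times> nat) set" where
  "dense_pairs q = {(3, 4), (3, 5)} \<union> clique_pairs q"

text \<open>Let \<open>s = \<xi>\<^sub>0 + \<xi>\<^sub>1\<close>. The equations of the hubs add up to \<open>\<Sum> \<xi> = 1 - (q - 1) s / 2\<close>, so it is enough to
  show \<open>\<Sum> \<xi> \<ge> 1\<close>. For the test vector, the lower bound is at least \<open>1/3 + (7 w + 9) / (10 w + 21)\<close>, which reaches \<open>1\<close>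
  exactly when \<open>w \<ge> 15\<close>, that is, \<open>q \<ge> 21\<close>.\<close>

lemma dense_family:
  assumes q: "q \<ge> 21" and e: "2 * e \<le> (q - 4) * (q - 5) + 4"
  shows "\<exists>(V :: (nat \<Rightarrow>\<^sub>0 real) set) br. lie_algebra V br \<and> indecomposable V br \<and>
    two_step_nilpotent V br \<and> has_type V br (2 * q - 3 + e) q \<and> \<not> einstein_nilradical V br"
proof -
  have disj: "{(3, 4), (3, 5)} \<inter> clique_pairs q = {}" by (auto simp: clique_pairs_def)
  have "card (dense_pairs q) = 2 + card (clique_pairs q)"
    unfolding dense_pairs_def using disj finite_clique_pairs by (subst card_Un_disjoint) auto
  moreover have "2 * card (clique_pairs q) = (q - 4) * (q - 5)"
    using card_clique_pairs[of "q - 4"] q by simp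
  ultimately have "e \<le> card (dense_pairs q)" using e by simp
  then obtain R where Re: "R \<subseteq> dense_pairs q" "card R = e"
    by (meson obtain_subset_with_card_n)
  have R2: "R \<subseteq> {(u, v). 3 \<le> u \<and> u < v \<and> v < q}"
    using Re(1) q by (auto simp: dense_pairs_def clique_pairs_def)
  interpret two_hub_graph q "{2..<q}" "{2..<q}" R
  proof
    show "\<exists>r'\<in>{2..<q}. r' \<noteq> r \<and> (r, r') \<notin> R \<and> (r', r) \<notin> R" for r
      using q R2 by (intro bexI[of _ "if r = 2 then 3 else 2"]) auto
  qed (use q R2 in auto)
  define w where "w = q - 6"
  have w: "q = w + 6" "w \<ge> 15" using q by (auto simp: w_def)
  define N where "N = 10 * real w + 21"
  have N: "N > 0" by (simp add: N_def)
  define \<eta> where "\<eta> v = (if v < 2 then 0 else if v = 2 then 1/3 else test_weight w v / N)" for v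
  have sum_split: "(\<Sum>v\<in>{2..<q}. f v) = f 2 + f 3 + f 4 + f 5 + (\<Sum>v\<in>{6..<q}. f v)" for f :: "nat \<Rightarrow> real"
    using q by (simp add: sum.atLeast_Suc_lessThan eval_nat_numeral)
  have S1: "(\<Sum>v<q. \<eta> v) = 1/3 + (7 * real w + 9) / N"
    unfolding sum_vertices sum_split
    by (simp add: \<eta>_def test_weight_def w(1) add_divide_distrib)
  have S2: "(\<Sum>v<q. (\<eta> v)\<^sup>2) = 1/9 + ((2 * real w + 3)\<^sup>2 + 18 + 25 * real w) / N\<^sup>2"
    unfolding sum_vertices sum_split
    by (simp add: \<eta>_def test_weight_def w(1) power_divide) (simp add: add_divide_distrib[symmetric])
  have SR: "(\<Sum>(u,v)\<in>R. (\<eta> u + \<eta> v)\<^sup>2)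
    \<le> (2 * (2 * real w + 6)\<^sup>2 + (36 + 128 * real w + 50 * real w * (real w - 1))) / N\<^sup>2"
  proof -
    have "(\<Sum>(u,v)\<in>R. (\<eta> u + \<eta> v)\<^sup>2) \<le> (\<Sum>(u,v)\<in>dense_pairs q. (\<eta> u + \<eta> v)\<^sup>2)"
      using Re(1) finite_clique_pairs by (intro sum_mono2) (auto simp: dense_pairs_def)
    also have "\<dots> = (\<Sum>(u,v)\<in>{(3, 4), (3, 5)}. (\<eta> u + \<eta> v)\<^sup>2) + (\<Sum>(u,v)\<in>clique_pairs q. (\<eta> u + \<eta> v)\<^sup>2)"
      unfolding dense_pairs_def using disj finite_clique_pairs by (intro sum.union_disjoint) auto
    also have "(\<Sum>(u,v)\<in>{(3, 4), (3, 5)}. (\<eta> u + \<eta> v)\<^sup>2) = 2 * (2 * real w + 6)\<^sup>2 / N\<^sup>2"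
      by (simp add: \<eta>_def test_weight_def power_divide add_divide_distrib[symmetric])
    also have "(\<Sum>(u,v)\<in>clique_pairs q. (\<eta> u + \<eta> v)\<^sup>2)
        = (\<Sum>(u,v)\<in>clique_pairs q. (test_weight w u + test_weight w v)\<^sup>2 / N\<^sup>2)"
      by (intro sum.cong refl) (auto simp: clique_pairs_def \<eta>_def power_divide add_divide_distrib[symmetric])
    also have "\<dots> = (\<Sum>(u,v)\<in>clique_pairs q. (test_weight w u + test_weight w v)\<^sup>2) / N\<^sup>2"
      by (simp add: sum_divide_distrib case_prod_unfold)
    also have "\<dots> = (36 + 128 * real w + 50 * real w * (real w - 1)) / N\<^sup>2"
      unfolding w(1) sum_test_weight_clique ..
    finally show ?thesis by (simp add: add_divide_distrib)
  qed
  have SE: "(\<Sum>(u,v)\<in>E. (\<eta> u + \<eta> v)\<^sup>2) = 2 * (\<Sum>v<q. (\<eta> v)\<^sup>2) + (\<Sum>(u,v)\<in>R. (\<eta> u + \<eta> v)\<^sup>2)"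
    unfolding sum_E sum_vertices by (simp add: \<eta>_def)
  have test: "2 * (\<Sum>v<q. \<eta> v) - (\<Sum>v<q. (\<eta> v)\<^sup>2) - (\<Sum>(u,v)\<in>E. (\<eta> u + \<eta> v)\<^sup>2) \<ge> 1"
  proof -
    define X where "X = ((2 * real w + 3)\<^sup>2 + 18 + 25 * real w) / N\<^sup>2"
    define Y where "Y = (2 * (2 * real w + 6)\<^sup>2 + (36 + 128 * real w + 50 * real w * (real w - 1))) / N\<^sup>2"
    define Z where "Z = (7 * real w + 9) / N"
    have "3 * ((2 * real w + 3)\<^sup>2 + 18 + 25 * real w)
        + (2 * (2 * real w + 6)\<^sup>2 + (36 + 128 * real w + 50 * real w * (real w - 1))) = N * (7 * real w + 9)"
      by (simp add: N_def power2_eq_square algebra_simps)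
    then have "3 * (((2 * real w + 3)\<^sup>2 + 18 + 25 * real w) / N\<^sup>2)
        + (2 * (2 * real w + 6)\<^sup>2 + (36 + 128 * real w + 50 * real w * (real w - 1))) / N\<^sup>2 = (7 * real w + 9) / N"
      using N by (simp add: power2_eq_square flip: add_divide_distrib)
    moreover have "(7 * real w + 9) / N \<ge> 2/3" using w by (simp add: N_def field_simps)
    ultimately have "Z \<ge> 2/3" "3 * X + Y = Z" unfolding X_def Y_def Z_def by auto
    moreover have "(\<Sum>(u,v)\<in>R. (\<eta> u + \<eta> v)\<^sup>2) \<le> Y" using SR unfolding Y_def .
    moreover have "(\<Sum>v<q. \<eta> v) = 1/3 + Z" "(\<Sum>v<q. (\<eta> v)\<^sup>2) = 1/9 + X"
      using S1 S2 unfolding X_def Z_def by auto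
    ultimately show ?thesis unfolding SE by linarith
  qed
  have "\<xi> 0 + \<xi> 1 \<le> 0" if \<xi>: "soliton_weights \<xi>" for \<xi>
  proof -
    have "(\<Sum>v<q. \<xi> v) \<ge> 1" using soliton_weights_sum_ge[OF \<xi>, of \<eta>] test by simp
    moreover have "3 * (\<xi> 0 + \<xi> 1) + real (q - 2) * (\<xi> 0 + \<xi> 1) + 2 * (\<Sum>v\<in>{2..<q}. \<xi> v) = 2"
    proof -
      define h :: "nat \<Rightarrow> real" where "h v = (if v < 2 then 1 else 0)" for v
      have h0: "h v = 0" if "v \<ge> 2" for v using that by (simp add: h_def)
      have "(\<Sum>v\<in>{2..<q}. h v * \<xi> v) = 0" "(\<Sum>v\<in>{2..<q}. h v) = 0"
        "(\<Sum>v\<in>{2..<q}. (h 0 + h v) * (\<xi> 0 + \<xi> v)) = (\<Sum>v\<in>{2..<q}. \<xi> 0 + \<xi> v)"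
        "(\<Sum>v\<in>{2..<q}. (h 1 + h v) * (\<xi> 1 + \<xi> v)) = (\<Sum>v\<in>{2..<q}. \<xi> 1 + \<xi> v)"
        "(\<Sum>(u,v)\<in>R. (h u + h v) * (\<xi> u + \<xi> v)) = 0"
        using R2 by (auto intro!: sum.neutral sum.cong simp: h_def)
      then show ?thesis
        using soliton_weights_eq[OF \<xi>, of h] by (simp add: h_def sum.distrib algebra_simps)
    qed
    ultimately have "real (q - 2) * (\<xi> 0 + \<xi> 1) + (\<xi> 0 + \<xi> 1) \<le> 0" unfolding sum_vertices by simp
    then have "(real (q - 2) + 1) * (\<xi> 0 + \<xi> 1) \<le> 0" by (simp add: algebra_simps)
    then show ?thesis by (simp add: mult_le_0_iff)
  qed
  note algebra = two_hub_algebra[OF this]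
  have "1 + card {2..<q} + card {2..<q} + card R = 2 * q - 3 + e" using Re(2) q by simp
  then show ?thesis using algebra by simp
qed

section \<open>All types in the range\<close>

theorem theorem1p2:
  fixes p q :: nat
  assumes "q \<ge> 21"
    and "real q - 1 \<le> real p"
    and "real p \<le> 1/2 * (real q)\<^sup>2 - 5/2 * real q + 9"
  shows "\<exists>(V :: (nat \<Rightarrow>\<^sub>0 real) set) br.
           lie_algebra V br \<and> indecomposable V br \<and> two_step_nilpotent V br \<and>
           has_type V br p q \<and> \<not> einstein_nilradical V br"
proof (cases "p \<le> 2 * q - 4")
  case True
  have "q \<le> p + 1" using assms(2) by linarith
  then have "p = q - 1 + (p - (q - 1))" "p - (q - 1) \<le> q - 3" using True assms(1) by linarith+
  then show ?thesis using sparse_family[OF assms(1), of "p - (q - 1)"] by simp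
next
  case False
  define e where "e = p - (2 * q - 3)"
  have p: "p = 2 * q - 3 + e" using False by (simp add: e_def)
  define m where "m = q - 5"
  have m: "q = m + 5" using assms(1) by (simp add: m_def)
  have "2 * real e \<le> (real m + 1) * real m + 4"
    using assms(3) unfolding p m by (simp add: power2_eq_square field_simps)
  then have "real (2 * e) \<le> real ((m + 1) * m + 4)" by (simp add: algebra_simps)
  then have "2 * e \<le> (m + 1) * m + 4" by linarith
  then have "2 * e \<le> (q - 4) * (q - 5) + 4" by (simp add: m)
  then show ?thesis using dense_family[OF assms(1)] p by simp
qed

end
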